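(* Let $F$ be a non-archimedean local field over a dyadic place $\mathfrak{p}$, with valuation ring $\mathfrak{o}$, and let $H\cong End(V)$ be a split quaternion algebra over $F$ ($V$ a $2$-dimensional $F$-vector space) with an orthogonal involution $\ddagger$. Let $\lambda\in disc(\ddagger)\cap\mathfrak{o}$ with $\lambda\mathfrak{o}=\iota(disc(\ddagger))$, and suppose $\mathfrak{d}(-\lambda)=\mathfrak{p}$. Let $\mathcal{O}$ be a maximal $\ddagger$-order. Then there exist a fractional ideal $\mathfrak{a}$ of $F$ and an $\mathfrak{a}$-maximal lattice $\Lambda\subset V$ such that $$\mathcal{O}=End(\Lambda)\cap End(\Lambda^\sharp).$$ Furthermore, all maximal $\ddagger$-orders are isomorphic (i.e. any two are mapped to each other by an automorphism of $(H,\ddagger)$), and $$disc(\mathcal{O})=disc(H)\cap\iota(disc(\ddagger)).$$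
   Context: Orthogonal involution: $F$-linear anti-automorphism of order $2$ with $3$-dimensional $+1$-eigenspace. Orders are $\mathfrak{o}$-lattice subrings with $1$ spanning $H$; a $\ddagger$-order satisfies $\mathcal{O}^\ddagger=\mathcal{O}$; a maximal $\ddagger$-order is not properly contained in another $\ddagger$-order. $b_\ddagger$ is a nondegenerate symmetric bilinear form on $V$ (fixed up to scaling) with $b_\ddagger(v,\sigma w)=b_\ddagger(\sigma^\ddagger v,w)$, $q_\ddagger(v)=b_\ddagger(v,v)$. Lattices: finitely generated $\mathfrak{o}$-submodules spanning $V$; $\Lambda^\sharp=\{v:b_\ddagger(v,\Lambda)\subset\mathfrak{o}\}$; $End(\Lambda)=\{\sigma:\sigma\Lambda\subset\Lambda\}$; $\mathfrak{n}\Lambda$ = fractional ideal generated by $q_\ddagger(\Lambda)$; $\Lambda$ is $\mathfrak{a}$-maximal if $\mathfrak{n}\Lambda\subset\mathfrak{a}$ and no lattice $\Lambda'\supsetneq\Lambda$ has $\mathfrak{n}\Lambda'\subset\mathfrak{a}$. $disc(\mathcal{O})$ = reduced discriminant, $disc(H)=\mathfrak{o}$ (split). $disc(\ddagger)=nrd(h)(F^\times)^2$ for nonzero $h$ with $h^\ddagger=-h$; $\iota([\mu])$ = ideal of $\mathfrak{o}$ generated by $[\mu]\cap\mathfrak{o}$. Quadratic defect: $\mathfrak{d}(\alpha)=\bigcap_{\xi\in F}(\alpha-\xi^2)\mathfrak{o}$. *)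

theory Defs
  imports "HOL-Analysis.Analysis"
begin

section \<open>Discrete valuations and non-archimedean local fields\<close>

text \<open>A valuation is a map v :: F => int; its value at 0 is irrelevant (all
  definitions guard against 0).\<close>

definition vring :: "('a::field \<Rightarrow> int) \<Rightarrow> 'a set" where
  "vring v = {x. x = 0 \<or> 0 \<le> v x}"

definition vprime :: "('a::field \<Rightarrow> int) \<Rightarrow> 'a set" where
  "vprime v = {x. x = 0 \<or> 0 < v x}"

definition discrete_valuation :: "('a::field \<Rightarrow> int) \<Rightarrow> bool" where
  "discrete_valuation v \<longleftrightarrow>
     (\<forall>x y. x \<noteq> 0 \<longrightarrow> y \<noteq> 0 \<longrightarrow> v (x * y) = v x + v y) \<and>
     (\<forall>x y. x \<noteq> 0 \<longrightarrow> y \<noteq> 0 \<longrightarrow> x + y \<noteq> 0 \<longrightarrow> min (v x) (v y) \<le> v (x + y)) \<and>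
     (\<exists>p. p \<noteq> 0 \<and> v p = 1)"

definition v_close :: "('a::field \<Rightarrow> int) \<Rightarrow> int \<Rightarrow> 'a \<Rightarrow> 'a \<Rightarrow> bool" where
  "v_close v N x y \<longleftrightarrow> x = y \<or> N \<le> v (x - y)"

definition v_complete :: "('a::field \<Rightarrow> int) \<Rightarrow> bool" where
  "v_complete v \<longleftrightarrow>
     (\<forall>f :: nat \<Rightarrow> 'a.
        (\<forall>N. \<exists>M. \<forall>m\<ge>M. \<forall>n\<ge>M. v_close v N (f m) (f n)) \<longrightarrow>
        (\<exists>l. \<forall>N. \<exists>M. \<forall>n\<ge>M. v_close v N (f n) l))"

definition residue_rel :: "('a::field \<Rightarrow> int) \<Rightarrow> ('a \<times> 'a) set" where
  "residue_rel v = {(x, y). x \<in> vring v \<and> y \<in> vring v \<and> x - y \<in> vprime v}"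

definition nonarch_local_field :: "('a::field \<Rightarrow> int) \<Rightarrow> bool" where
  "nonarch_local_field v \<longleftrightarrow>
     discrete_valuation v \<and> v_complete v \<and> finite (vring v // residue_rel v)"

text \<open>Dyadic: the place lies over 2, i.e. 2 is in the maximal ideal.\<close>
definition dyadic :: "('a::field \<Rightarrow> int) \<Rightarrow> bool" where
  "dyadic v \<longleftrightarrow> 0 < v 2"

section \<open>o-modules, lattices, fractional ideals\<close>

definition o_gen :: "('a::field \<Rightarrow> int) \<Rightarrow> ('a \<Rightarrow> 'b \<Rightarrow> 'b) \<Rightarrow> 'b::comm_monoid_add set \<Rightarrow> 'b set" where
  "o_gen v sm S = {\<Sum>x\<in>T. sm (c x) x | T c. finite T \<and> T \<subseteq> S \<and> (\<forall>x\<in>T. c x \<in> vring v)}"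

definition F_span :: "('a::field \<Rightarrow> 'b \<Rightarrow> 'b) \<Rightarrow> 'b::comm_monoid_add set \<Rightarrow> 'b set" where
  "F_span sm S = {\<Sum>x\<in>T. sm (c x) x | T c. finite T \<and> T \<subseteq> S}"

text \<open>A lattice: finitely generated o-submodule spanning the whole space.\<close>
definition o_lattice :: "('a::field \<Rightarrow> int) \<Rightarrow> ('a \<Rightarrow> 'b \<Rightarrow> 'b) \<Rightarrow> 'b::comm_monoid_add set \<Rightarrow> bool" where
  "o_lattice v sm L \<longleftrightarrow> (\<exists>S. finite S \<and> L = o_gen v sm S) \<and> F_span sm L = UNIV"

definition frac_ideal :: "('a::field \<Rightarrow> int) \<Rightarrow> 'a set \<Rightarrow> bool" where
  "frac_ideal v I \<longleftrightarrow> o_lattice v (*) I"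

definition ideal_mult :: "('a::field \<Rightarrow> int) \<Rightarrow> 'a set \<Rightarrow> 'a set \<Rightarrow> 'a set" where
  "ideal_mult v I K = o_gen v (*) {x * y | x y. x \<in> I \<and> y \<in> K}"

section \<open>The split quaternion algebra H = End(V), V = F^2\<close>

definition msc :: "'a::field \<Rightarrow> 'a^2^2 \<Rightarrow> 'a^2^2" where
  "msc c A = (\<chi> i j. c * A $ i $ j)"

definition fdim :: "('a::field \<Rightarrow> 'b \<Rightarrow> 'b) \<Rightarrow> 'b::comm_monoid_add set \<Rightarrow> nat \<Rightarrow> bool" where
  "fdim sm W n \<longleftrightarrow> (\<exists>f :: nat \<Rightarrow> 'b.
      (\<forall>c. (\<Sum>i<n. sm (c i) (f i)) = 0 \<longrightarrow> (\<forall>i<n. c i = 0)) \<and>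
      W = {\<Sum>i<n. sm (c i) (f i) | c. True})"

text \<open>Orthogonal involution: F-linear anti-automorphism of order 2 whose
  +1-eigenspace is 3-dimensional.\<close>
definition orth_inv :: "('a::field^2^2 \<Rightarrow> 'a^2^2) \<Rightarrow> bool" where
  "orth_inv J \<longleftrightarrow>
     (\<forall>A B. J (A + B) = J A + J B) \<and> (\<forall>c A. J (msc c A) = msc c (J A)) \<and>
     (\<forall>A B. J (A ** B) = J B ** J A) \<and> (\<forall>A. J (J A) = A) \<and> J \<noteq> id \<and>
     fdim msc {A. J A = A} 3"

definition is_order :: "('a::field \<Rightarrow> int) \<Rightarrow> ('a^2^2) set \<Rightarrow> bool" where
  "is_order v R \<longleftrightarrow> o_lattice v msc R \<and> mat 1 \<in> R \<and> (\<forall>A\<in>R. \<forall>B\<in>R. A ** B \<in> R)"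

definition dagger_order :: "('a::field \<Rightarrow> int) \<Rightarrow> ('a^2^2 \<Rightarrow> 'a^2^2) \<Rightarrow> ('a^2^2) set \<Rightarrow> bool" where
  "dagger_order v J R \<longleftrightarrow> is_order v R \<and> J ` R = R"

definition max_dagger_order :: "('a::field \<Rightarrow> int) \<Rightarrow> ('a^2^2 \<Rightarrow> 'a^2^2) \<Rightarrow> ('a^2^2) set \<Rightarrow> bool" where
  "max_dagger_order v J R \<longleftrightarrow> dagger_order v J R \<and> \<not> (\<exists>R'. dagger_order v J R' \<and> R \<subset> R')"

text \<open>Automorphisms of (H, J): F-algebra automorphisms commuting with J.\<close>
definition dagger_auto :: "('a::field^2^2 \<Rightarrow> 'a^2^2) \<Rightarrow> ('a^2^2 \<Rightarrow> 'a^2^2) \<Rightarrow> bool" where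
  "dagger_auto J f \<longleftrightarrow> bij f \<and> (\<forall>A B. f (A + B) = f A + f B) \<and>
     (\<forall>A B. f (A ** B) = f A ** f B) \<and> (\<forall>c A. f (msc c A) = msc c (f A)) \<and>
     f (mat 1) = mat 1 \<and> (\<forall>A. f (J A) = J (f A))"

section \<open>The form b attached to J, lattices in V\<close>

definition adapted_form :: "('a::field^2^2 \<Rightarrow> 'a^2^2) \<Rightarrow> ('a^2 \<Rightarrow> 'a^2 \<Rightarrow> 'a) \<Rightarrow> bool" where
  "adapted_form J b \<longleftrightarrow>
     (\<forall>x y z. b (x + y) z = b x z + b y z) \<and> (\<forall>c x y. b (c *s x) y = c * b x y) \<and>
     (\<forall>x y. b x y = b y x) \<and> (\<forall>x. (\<forall>y. b x y = 0) \<longrightarrow> x = 0) \<and>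
     (\<forall>s x y. b x (s *v y) = b (J s *v x) y)"

definition vlattice :: "('a::field \<Rightarrow> int) \<Rightarrow> ('a^2) set \<Rightarrow> bool" where
  "vlattice v L \<longleftrightarrow> o_lattice v (*s) L"

definition dual_lat :: "('a::field \<Rightarrow> int) \<Rightarrow> ('a^2 \<Rightarrow> 'a^2 \<Rightarrow> 'a) \<Rightarrow> ('a^2) set \<Rightarrow> ('a^2) set" where
  "dual_lat v b L = {x. \<forall>y\<in>L. b x y \<in> vring v}"

definition EndL :: "('a::field^2) set \<Rightarrow> ('a^2^2) set" where
  "EndL L = {s. \<forall>x\<in>L. s *v x \<in> L}"

definition norm_ideal :: "('a::field \<Rightarrow> int) \<Rightarrow> ('a^2 \<Rightarrow> 'a^2 \<Rightarrow> 'a) \<Rightarrow> ('a^2) set \<Rightarrow> 'a set" where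
  "norm_ideal v b L = o_gen v (*) ((\<lambda>x. b x x) ` L)"

definition a_maximal :: "('a::field \<Rightarrow> int) \<Rightarrow> ('a^2 \<Rightarrow> 'a^2 \<Rightarrow> 'a) \<Rightarrow> 'a set \<Rightarrow> ('a^2) set \<Rightarrow> bool" where
  "a_maximal v b a L \<longleftrightarrow> vlattice v L \<and> norm_ideal v b L \<subseteq> a \<and>
     \<not> (\<exists>L'. vlattice v L' \<and> L \<subset> L' \<and> norm_ideal v b L' \<subseteq> a)"

section \<open>Discriminants, quadratic defect\<close>

definition trd :: "'a::field^2^2 \<Rightarrow> 'a" where
  "trd A = (\<Sum>i\<in>UNIV. A $ i $ i)"

text \<open>Discriminant ideal d(O), generated by det(trd(x_i x_j)) for x_1..x_4 in O;
  the reduced discriminant is the ideal whose square is d(O).\<close>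
definition disc_ideal :: "('a::field \<Rightarrow> int) \<Rightarrow> ('a^2^2) set \<Rightarrow> 'a set" where
  "disc_ideal v R = o_gen v (*)
     {det ((\<chi> i j. trd (x i ** x j)) :: 'a^4^4) | x :: 4 \<Rightarrow> 'a^2^2. \<forall>i. x i \<in> R}"

definition reduced_disc :: "('a::field \<Rightarrow> int) \<Rightarrow> ('a^2^2) set \<Rightarrow> 'a set" where
  "reduced_disc v R = (THE D. frac_ideal v D \<and> ideal_mult v D D = disc_ideal v R)"

text \<open>disc(H) = o since H is split.\<close>
definition disc_H :: "('a::field \<Rightarrow> int) \<Rightarrow> 'a set" where
  "disc_H v = vring v"

definition disc_inv :: "('a::field^2^2 \<Rightarrow> 'a^2^2) \<Rightarrow> 'a set" where
  "disc_inv J = (let h = (SOME h. h \<noteq> 0 \<and> J h = - h) in {det h * c ^ 2 | c. c \<noteq> 0})"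

definition iota :: "('a::field \<Rightarrow> int) \<Rightarrow> 'a set \<Rightarrow> 'a set" where
  "iota v S = o_gen v (*) (S \<inter> vring v)"

definition qdefect :: "('a::field \<Rightarrow> int) \<Rightarrow> 'a \<Rightarrow> 'a set" where
  "qdefect v \<alpha> = (\<Inter>\<xi>. {(\<alpha> - \<xi> ^ 2) * c | c. c \<in> vring v})"

end

theory Submission
  imports Defs
begin

text \<open>Since the defect of \<open>- lam\<close> is the maximal ideal, some \<open>\<delta> = lam + \<xi>\<^sup>2\<close> is a
  uniformizer, and in a suitable basis of \<open>V\<close> the form is a multiple of the Eisenstein form
  \<open>X\<^sup>2 + 2 \<xi> X Y + \<delta> Y\<^sup>2\<close>, the norm form of a ramified quadratic extension \<open>K\<close>. Its value at
  \<open>(X, Y)\<close> has valuation \<open>min (2 v X) (2 v Y + 1)\<close>, so the sets cut out by \<open>q \<in> \<aa>\<close> are the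
  powers of the prime of \<open>K\<close>; up to scaling there are two of them, \<open>Lam 1\<close> and \<open>Lam \<delta>\<close>, and
  they are \<open>\<aa>\<close>-maximal.

  A \<open>J\<close>-stable order stabilises some lattice \<open>L\<close> together with its dual. Enlarging \<open>L\<close> inside
  its dual makes the quotient of the two killed by \<open>\<delta>\<close>. Then \<open>L \<subseteq> Lam 1 \<subseteq> D L\<close> with \<open>D L\<close> the dual, and as the
  quotient has length at most two, one of \<open>L\<close>, \<open>D L\<close> is \<open>Lam 1\<close>, or else \<open>L = Lam \<delta>\<close>. If \<open>lam\<close>
  is a unit, both lattices are self-dual up to scaling and their endomorphism rings are exchanged
  by the uniformizer of \<open>K\<close>, a similitude; if \<open>lam\<close> is a uniformizer, the lattices are dual to
  each other up to scaling and the only maximal order is the Eichler order stabilising both.\<close>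

section \<open>Modules generated over the valuation ring\<close>

definition o_submodule :: "('a::field \<Rightarrow> int) \<Rightarrow> ('a \<Rightarrow> 'b \<Rightarrow> 'b) \<Rightarrow> 'b::comm_monoid_add set \<Rightarrow> bool" where
  "o_submodule v sm N \<longleftrightarrow> 0 \<in> N \<and> (\<forall>x\<in>N. \<forall>y\<in>N. x + y \<in> N) \<and> (\<forall>r\<in>vring v. \<forall>x\<in>N. sm r x \<in> N)"

lemma o_submoduleD:
  assumes "o_submodule v sm N"
  shows "0 \<in> N" "x \<in> N \<Longrightarrow> y \<in> N \<Longrightarrow> x + y \<in> N" "r \<in> vring v \<Longrightarrow> x \<in> N \<Longrightarrow> sm r x \<in> N"
  using assms by (auto simp: o_submodule_def)

lemma o_gen_subset:
  assumes "o_submodule v sm N" "S \<subseteq> N"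
  shows "o_gen v sm S \<subseteq> N"
proof
  fix y assume "y \<in> o_gen v sm S"
  then obtain T c where T: "y = (\<Sum>x\<in>T. sm (c x) x)" "finite T" "T \<subseteq> S" "\<forall>x\<in>T. c x \<in> vring v"
    by (auto simp: o_gen_def)
  have "(\<Sum>x\<in>T. sm (c x) x) \<in> N"
    using T(2-) by (induction T rule: finite_induct) (use assms in \<open>auto simp: o_submodule_def\<close>)
  with T show "y \<in> N" by simp
qed

lemma o_gen_scaled:
  assumes "x \<in> S" "r \<in> vring v"
  shows "sm r x \<in> o_gen v sm S"
  unfolding o_gen_def using assms by (intro CollectI exI[of _ "{x}"] exI[of _ "\<lambda>_. r"]) auto

text \<open>Once a nonzero multiple of a vector lies in \<open>L\<close>, the vector itself is a
  one-term combination; spanning thus reduces to clearing denominators.\<close>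

lemma F_span_UNIV_if_absorbing:
  fixes sm :: "'a::field \<Rightarrow> 'b::ab_group_add \<Rightarrow> 'b"
  assumes "module sm" "\<And>x. \<exists>d. d \<noteq> 0 \<and> sm d x \<in> L"
  shows "F_span sm L = UNIV"
proof -
  interpret module sm by fact
  have "x \<in> F_span sm L" for x
  proof -
    obtain d where d: "d \<noteq> 0" "sm d x \<in> L" using assms(2) by blast
    have "x = (\<Sum>y\<in>{sm d x}. sm (1 / d) y)" using d by simp
    then show ?thesis
      unfolding F_span_def using d by (intro CollectI exI[of _ "{sm d x}"] exI[of _ "\<lambda>_. 1 / d"]) auto
  qed
  then show ?thesis by blast
qed

section \<open>The valuation ring\<close>

locale dval =
  fixes v :: "'a::field \<Rightarrow> int"
  assumes dv: "discrete_valuation v"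
begin

lemma v_mult: "x \<noteq> 0 \<Longrightarrow> y \<noteq> 0 \<Longrightarrow> v (x * y) = v x + v y"
  using dv by (auto simp: discrete_valuation_def)

lemma v_add: "x \<noteq> 0 \<Longrightarrow> y \<noteq> 0 \<Longrightarrow> x + y \<noteq> 0 \<Longrightarrow> min (v x) (v y) \<le> v (x + y)"
  using dv by (auto simp: discrete_valuation_def)

lemma v_1: "v 1 = 0"
  using v_mult[of 1 1] by simp

lemma v_minus: "v (- x) = v x"
proof (cases "x = 0")
  case False
  have "v (- 1) = 0" using v_mult[of "-1" "-1"] v_1 by simp
  with False v_mult[of "-1" x] show ?thesis by simp
qed simp

lemma v_inverse: "x \<noteq> 0 \<Longrightarrow> v (inverse x) = - v x"
  using v_mult[of x "inverse x"] v_1 by simp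

lemma v_divide: "x \<noteq> 0 \<Longrightarrow> y \<noteq> 0 \<Longrightarrow> v (x / y) = v x - v y"
  by (simp add: divide_inverse v_mult v_inverse)

lemma v_power: "x \<noteq> 0 \<Longrightarrow> v (x ^ n) = int n * v x"
  by (induction n) (auto simp: v_1 v_mult algebra_simps)

text \<open>The isosceles principle of ultrametrics. The disjunct \<open>y = 0\<close> plays the
  part of infinite valuation, because \<open>v 0\<close> is an arbitrary integer.\<close>

lemma v_add_strict:
  assumes "x \<noteq> 0" "y = 0 \<or> v x < v y"
  shows "x + y \<noteq> 0 \<and> v (x + y) = v x"
proof (cases "y = 0")
  case False
  with assms have lt: "v x < v y" by simp
  have nz: "x + y \<noteq> 0"
  proof
    assume "x + y = 0"
    then have "y = - x" by (simp add: eq_neg_iff_add_eq_0 add.commute)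
    with lt show False by (simp add: v_minus)
  qed
  have "min (v (x + y)) (v (- y)) \<le> v (x + y + (- y))"
    using nz False assms(1) by (intro v_add) auto
  with v_add[OF assms(1) False nz] lt nz show ?thesis by (simp add: v_minus)
qed (use assms in simp)

abbreviation \<oo> where "\<oo> \<equiv> vring v"

lemma O_iff: "x \<in> \<oo> \<longleftrightarrow> x = 0 \<or> 0 \<le> v x"
  by (simp add: vring_def)

lemma O_0 [simp]: "0 \<in> \<oo>" and O_1 [simp]: "1 \<in> \<oo>"
  by (auto simp: O_iff v_1)

lemma O_minus_iff [simp]: "- x \<in> \<oo> \<longleftrightarrow> x \<in> \<oo>"
  by (simp add: O_iff v_minus)

lemma O_add: "x \<in> \<oo> \<Longrightarrow> y \<in> \<oo> \<Longrightarrow> x + y \<in> \<oo>"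
  using v_add[of x y] by (force simp: O_iff)

lemma O_mult: "x \<in> \<oo> \<Longrightarrow> y \<in> \<oo> \<Longrightarrow> x * y \<in> \<oo>"
  by (cases "x = 0 \<or> y = 0") (auto simp: O_iff v_mult)

lemma O_diff: "x \<in> \<oo> \<Longrightarrow> y \<in> \<oo> \<Longrightarrow> x - y \<in> \<oo>"
  using O_add[of x "- y"] by simp

lemma O_power: "x \<in> \<oo> \<Longrightarrow> x ^ n \<in> \<oo>"
  by (induction n) (auto intro: O_mult)

lemma O_sum: "(\<And>i. i \<in> I \<Longrightarrow> f i \<in> \<oo>) \<Longrightarrow> sum f I \<in> \<oo>"
  by (induction I rule: infinite_finite_induct) (auto intro: O_add)

lemma O_prod: "(\<And>i. i \<in> I \<Longrightarrow> f i \<in> \<oo>) \<Longrightarrow> prod f I \<in> \<oo>"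
  by (induction I rule: infinite_finite_induct) (auto intro: O_mult)

lemma O_2 [simp]: "2 \<in> \<oo>"
  using O_add[of 1 1] by simp

lemma O_det:
  fixes X :: "'a^'n^'n"
  assumes "\<And>i j. X $ i $ j \<in> \<oo>"
  shows "det X \<in> \<oo>"
  unfolding det_def
proof (intro O_sum O_mult O_prod assms)
  fix p :: "'n \<Rightarrow> 'n"
  show "of_int (sign p) \<in> \<oo>" by (auto simp: sign_def)
qed

lemma O_divide_iff: "y \<noteq> 0 \<Longrightarrow> x / y \<in> \<oo> \<longleftrightarrow> x = 0 \<or> v y \<le> v x"
  by (cases "x = 0") (auto simp: O_iff v_divide)

section \<open>Principal ideals and square roots of ideals\<close>

lemma principal_ideal_eq: "z \<noteq> 0 \<Longrightarrow> {z * r | r. r \<in> \<oo>} = {x. x / z \<in> \<oo>}"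
  by (auto intro!: exI[of _ "_ / z"])

lemma principal_mem: "r \<in> \<oo> \<Longrightarrow> x = z * r \<Longrightarrow> x \<in> {z * r | r. r \<in> \<oo>}"
  by blast

lemma principal_ideal_cong:
  assumes "z \<noteq> 0" "w \<noteq> 0" "v z = v w"
  shows "{z * r | r. r \<in> \<oo>} = {w * r | r. r \<in> \<oo>}"
  using assms by (simp add: principal_ideal_eq O_divide_iff)

lemma principal_ideal_inj:
  assumes "z \<noteq> 0" "w \<noteq> 0" "{z * r | r. r \<in> \<oo>} = {w * r | r. r \<in> \<oo>}"
  shows "v z = v w"
proof -
  have eq: "x / z \<in> \<oo> \<longleftrightarrow> x / w \<in> \<oo>" for x
    using assms(3) unfolding principal_ideal_eq[OF assms(1)] principal_ideal_eq[OF assms(2)] by blast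
  from eq[of z] eq[of w] assms show ?thesis by (auto simp: O_divide_iff)
qed

lemma principal_submodule: "o_submodule v (*) {z * r | r. r \<in> \<oo>}"
  unfolding o_submodule_def
proof (intro conjI ballI)
  show "0 \<in> {z * r | r. r \<in> \<oo>}" by (rule principal_mem[of 0]) auto
  fix x assume "x \<in> {z * r | r. r \<in> \<oo>}"
  then obtain r where r: "x = z * r" "r \<in> \<oo>" by blast
  show "s * x \<in> {z * r | r. r \<in> \<oo>}" if "s \<in> \<oo>" for s
    using that r by (intro principal_mem[of "s * r"] O_mult) simp_all
  fix y assume "y \<in> {z * r | r. r \<in> \<oo>}"
  then obtain s where "y = z * s" "s \<in> \<oo>" by blast
  with r show "x + y \<in> {z * r | r. r \<in> \<oo>}"
    by (intro principal_mem[of "r + s"] O_add) (simp_all add: algebra_simps)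
qed

lemma o_gen_principal:
  assumes "z \<in> S" "S \<subseteq> {z * r | r. r \<in> \<oo>}"
  shows "o_gen v (*) S = {z * r | r. r \<in> \<oo>}"
proof
  show "o_gen v (*) S \<subseteq> {z * r |r. r \<in> \<oo>}"
    by (rule o_gen_subset[OF principal_submodule assms(2)])
  show "{z * r |r. r \<in> \<oo>} \<subseteq> o_gen v (*) S"
    using o_gen_scaled[OF assms(1), of _ v "(*)"] by (auto simp: mult.commute)
qed

lemma frac_ideal_principal:
  assumes "z \<noteq> 0"
  shows "frac_ideal v {z * r | r. r \<in> \<oo>}"
  unfolding frac_ideal_def o_lattice_def
proof (intro conjI exI[of _ "{z}"])
  show "{z * r | r. r \<in> \<oo>} = o_gen v (*) {z}"
    using principal_mem[of 1 z z] by (intro o_gen_principal[symmetric]) auto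
  have "\<exists>d. d \<noteq> 0 \<and> d * x \<in> {z * r |r. r \<in> \<oo>}" for x
  proof (cases "x = 0")
    case False
    with assms principal_mem[of 1 z z] show ?thesis by (intro exI[of _ "z / x"]) auto
  next
    case True
    with principal_mem[of 0 0 z] show ?thesis by (intro exI[of _ 1]) auto
  qed
  moreover have "module ((*) :: 'a \<Rightarrow> 'a \<Rightarrow> 'a)" by unfold_locales (auto simp: algebra_simps)
  ultimately show "F_span (*) {z * r | r. r \<in> \<oo>} = UNIV" by (rule F_span_UNIV_if_absorbing[rotated])
qed auto

text \<open>A nonzero generator of least valuation divides all the others. One exists because the
  zero ideal does not span the field.\<close>

lemma frac_ideal_imp_principal:
  assumes "frac_ideal v I"
  shows "\<exists>z. z \<noteq> 0 \<and> I = {z * r | r. r \<in> \<oo>}"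
proof -
  obtain S where S: "finite S" "I = o_gen v (*) S" and span: "F_span (*) I = UNIV"
    using assms by (auto simp: frac_ideal_def o_lattice_def)
  \<comment> \<open>The value \<open>v 0\<close> is arbitrary, so 0 has to go before valuations are
    minimised.\<close>
  let ?S = "S - {0}"
  have "?S \<noteq> {}"
  proof
    assume "?S = {}"
    then have "S \<subseteq> {0}" by blast
    moreover have "{0 * r | r. r \<in> \<oo>} = {0 :: 'a}" using O_0 by (simp, blast)
    ultimately have I0: "I \<subseteq> {0}"
      using o_gen_subset[OF principal_submodule[of 0], of S] S(2) by simp
    have "(1::'a) \<in> F_span (*) I" unfolding span by (rule UNIV_I)
    then obtain T c where T: "(1::'a) = (\<Sum>x\<in>T. c x * x)" "T \<subseteq> I"
      unfolding F_span_def by (elim CollectE exE conjE)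
    have "(\<Sum>x\<in>T. c x * x) = 0"
      using T(2) I0 by (intro sum.neutral) auto
    with T(1) show False by simp
  qed
  moreover have "finite ?S" using S by simp
  ultimately obtain z where z: "z \<in> ?S" "\<And>y. y \<in> ?S \<Longrightarrow> v z \<le> v y"
    using arg_min_if_finite(1)[of ?S v] arg_min_least[of ?S _ v] by metis
  have "S \<subseteq> {z * r | r. r \<in> \<oo>}"
    using z by (subst principal_ideal_eq) (auto simp: O_divide_iff)
  then have "I = {z * r | r. r \<in> \<oo>}" using o_gen_principal[of z S] z S by simp
  with z show ?thesis by blast
qed

lemma ideal_mult_principal:
  "ideal_mult v {z * r | r. r \<in> \<oo>} {w * r | r. r \<in> \<oo>} = {z * w * r | r. r \<in> \<oo>}"
  unfolding ideal_mult_def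
proof (rule o_gen_principal)
  have "z \<in> {z * r |r. r \<in> \<oo>}" "w \<in> {w * r |r. r \<in> \<oo>}"
    by (rule principal_mem[of 1]; simp)+
  then show "z * w \<in> {x * y |x y. x \<in> {z * r |r. r \<in> \<oo>} \<and> y \<in> {w * r |r. r \<in> \<oo>}}"
    by blast
  show "{x * y |x y. x \<in> {z * r |r. r \<in> \<oo>} \<and> y \<in> {w * r |r. r \<in> \<oo>}} \<subseteq> {z * w * r |r. r \<in> \<oo>}"
  proof
    fix a assume "a \<in> {x * y |x y. x \<in> {z * r |r. r \<in> \<oo>} \<and> y \<in> {w * r |r. r \<in> \<oo>}}"
    then obtain r s where "a = (z * r) * (w * s)" "r \<in> \<oo>" "s \<in> \<oo>" by blast
    then show "a \<in> {z * w * r |r. r \<in> \<oo>}"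
      by (intro principal_mem[of "r * s"] O_mult) (simp_all add: ac_simps)
  qed
qed

text \<open>Settles the definite description: a competing square root is principal, with a generator
  \<open>w\<close> satisfying \<open>2 * v w = 2 * v z\<close>, and valuations determine principal
  ideals.\<close>

lemma reduced_disc_eq:
  assumes "z \<noteq> 0" "disc_ideal v R = {z ^ 2 * r | r. r \<in> \<oo>}"
  shows "reduced_disc v R = {z * r | r. r \<in> \<oo>}"
  unfolding reduced_disc_def
proof (rule the_equality)
  show "frac_ideal v {z * r |r. r \<in> \<oo>} \<and>
      ideal_mult v {z * r |r. r \<in> \<oo>} {z * r |r. r \<in> \<oo>} = disc_ideal v R"
    using frac_ideal_principal[OF assms(1)] assms(2) unfolding ideal_mult_principal power2_eq_square by simp
next
  fix D assume D: "frac_ideal v D \<and> ideal_mult v D D = disc_ideal v R"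
  from frac_ideal_imp_principal[OF conjunct1[OF D]]
  obtain w where w: "w \<noteq> 0" "D = {w * r | r. r \<in> \<oo>}" by (elim exE conjE)
  have "{w * w * r | r. r \<in> \<oo>} = {z * z * r | r. r \<in> \<oo>}"
    using conjunct2[OF D] unfolding assms(2) w(2) ideal_mult_principal power2_eq_square .
  then have "v (w * w) = v (z * z)" using w(1) assms(1) by (intro principal_ideal_inj) simp_all
  then have "v w = v z" using w(1) assms(1) by (simp add: v_mult)
  then show "D = {z * r | r. r \<in> \<oo>}" unfolding w(2) by (intro principal_ideal_cong w assms)
qed

text \<open>Combinations over different subsets of \<open>S\<close> are padded with zero
  coefficients to combinations over all of \<open>S\<close>, where they can be added term by
  term.\<close>

lemma o_gen_submodule:
  fixes sm :: "'a \<Rightarrow> 'b::ab_group_add \<Rightarrow> 'b"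
  assumes "module sm" "finite S"
  shows "o_submodule v sm (o_gen v sm S)"
proof -
  interpret module sm by fact
  have eq: "o_gen v sm S = {\<Sum>x\<in>S. sm (c x) x | c. \<forall>x\<in>S. c x \<in> \<oo>}" (is "_ = ?G")
  proof
    show "?G \<subseteq> o_gen v sm S" unfolding o_gen_def using assms(2) by blast
    show "o_gen v sm S \<subseteq> ?G"
    proof
      fix y assume "y \<in> o_gen v sm S"
      then obtain T c where T: "y = (\<Sum>x\<in>T. sm (c x) x)" "finite T" "T \<subseteq> S" "\<forall>x\<in>T. c x \<in> \<oo>"
        by (auto simp: o_gen_def)
      have "y = (\<Sum>x\<in>S. sm (if x \<in> T then c x else 0) x)"
        unfolding T(1) using T assms(2) by (intro sum.mono_neutral_cong_left) auto
      moreover have "\<forall>x\<in>S. (if x \<in> T then c x else 0) \<in> \<oo>" using T by auto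
      ultimately show "y \<in> ?G" by (intro CollectI exI[of _ "\<lambda>x. if x \<in> T then c x else 0"] conjI)
    qed
  qed
  show ?thesis
    unfolding eq o_submodule_def
  proof (intro conjI ballI)
    show "0 \<in> ?G" by (intro CollectI exI[of _ "\<lambda>_. 0"]) auto
  next
    fix x y assume "x \<in> ?G" "y \<in> ?G"
    then obtain c d where "x = (\<Sum>x\<in>S. sm (c x) x)" "\<forall>x\<in>S. c x \<in> \<oo>"
      "y = (\<Sum>x\<in>S. sm (d x) x)" "\<forall>x\<in>S. d x \<in> \<oo>" by blast
    then show "x + y \<in> ?G"
      by (intro CollectI exI[of _ "\<lambda>x. c x + d x"])
        (auto simp: scale_left_distrib sum.distrib intro: O_add)
  next
    fix r x assume "r \<in> \<oo>" "x \<in> ?G"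
    then obtain c where "x = (\<Sum>x\<in>S. sm (c x) x)" "\<forall>x\<in>S. c x \<in> \<oo>" by blast
    with \<open>r \<in> \<oo>\<close> show "sm r x \<in> ?G"
      by (intro CollectI exI[of _ "\<lambda>x. r * c x"]) (auto simp: scale_sum_right intro: O_mult)
  qed
qed

lemma o_gen_base: "module sm \<Longrightarrow> x \<in> S \<Longrightarrow> x \<in> o_gen v sm S"
  using o_gen_scaled[of x S 1 v sm] by (simp add: module.scale_one)

lemma o_latticeI:
  fixes sm :: "'a \<Rightarrow> 'b::ab_group_add \<Rightarrow> 'b"
  assumes "module sm" "o_submodule v sm L" "finite S" "S \<subseteq> L" "L \<subseteq> o_gen v sm S"
    "\<And>x. \<exists>d. d \<noteq> 0 \<and> sm d x \<in> L"
  shows "o_lattice v sm L"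
  unfolding o_lattice_def using F_span_UNIV_if_absorbing[OF assms(1,6)] o_gen_subset[OF assms(2,4)] assms(3,5)
  by blast

end

context dval
begin

section \<open>Denominators and lengths in a plane\<close>

text \<open>A non-integral element has an integral inverse, which clears it. Keeping the
  denominators integral allows them to be multiplied together.\<close>

lemma common_denominator:
  assumes "finite S"
  shows "\<exists>d\<in>\<oo>. d \<noteq> 0 \<and> (\<forall>x\<in>S. d * x \<in> \<oo>)"
  using assms
proof (induction S rule: finite_induct)
  case empty
  show ?case by (auto intro: bexI[of _ 1])
next
  case (insert x S)
  then obtain d where d: "d \<noteq> 0" "d \<in> \<oo>" "\<And>y. y \<in> S \<Longrightarrow> d * y \<in> \<oo>" by blast
  obtain e where e: "e \<noteq> 0" "e \<in> \<oo>" "e * x \<in> \<oo>"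
  proof (cases "x \<in> \<oo>")
    case True
    then show ?thesis using that[of 1] by simp
  next
    case False
    then show ?thesis using that[of "1 / x"] by (auto simp: O_iff v_divide v_1)
  qed
  have "d * e * y \<in> \<oo>" if "y \<in> insert x S" for y
    using that O_mult[OF d(2) e(3)] O_mult[OF e(2) d(3)[of y]] by (auto simp: ac_simps)
  with d e show ?case by (intro bexI[of _ "d * e"]) (auto intro: O_mult)
qed

text \<open>Three vectors of a plane are dependent; dividing a relation by a nonzero coefficient of
  least valuation makes all coefficients integral and one of them 1.\<close>

lemma linear_relation:
  fixes x y z :: "'a^2"
  obtains r s t where "r \<in> \<oo>" "s \<in> \<oo>" "t \<in> \<oo>" "r = 1 \<or> s = 1 \<or> t = 1"
    "r *s x + s *s y + t *s z = 0"
proof -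
  have "\<exists>r s t. (r \<noteq> 0 \<or> s \<noteq> 0 \<or> t \<noteq> 0) \<and> r *s x + s *s y + t *s z = 0"
  proof (cases "x $ 1 * y $ 2 - x $ 2 * y $ 1 = 0")
    case False
    \<comment> \<open>Cramer's rule: the coefficients are the 2 by 2 minors of the three
      vectors.\<close>
    then show ?thesis
      by (intro exI[of _ "y $ 1 * z $ 2 - y $ 2 * z $ 1"] exI[of _ "z $ 1 * x $ 2 - z $ 2 * x $ 1"]
          exI[of _ "x $ 1 * y $ 2 - x $ 2 * y $ 1"])
        (auto simp: vec_eq_iff forall_2 algebra_simps)
  next
    case True
    consider "x = 0" | "x $ 1 \<noteq> 0" | "x $ 2 \<noteq> 0" by (auto simp: vec_eq_iff forall_2)
    then show ?thesis
    proof cases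
      case 1
      then show ?thesis by (intro exI[of _ 1] exI[of _ 0]) simp
    next
      case 2
      with True show ?thesis
        by (intro exI[of _ "- y $ 1"] exI[of _ "x $ 1"] exI[of _ 0])
          (auto simp: vec_eq_iff forall_2 algebra_simps)
    next
      case 3
      with True show ?thesis
        by (intro exI[of _ "- y $ 2"] exI[of _ "x $ 2"] exI[of _ 0])
          (auto simp: vec_eq_iff forall_2 algebra_simps)
    qed
  qed
  then obtain r s t where rel: "r \<noteq> 0 \<or> s \<noteq> 0 \<or> t \<noteq> 0" "r *s x + s *s y + t *s z = 0" by blast
  let ?S = "{r, s, t} - {0}"
  obtain d where d: "d \<in> ?S" "\<And>e. e \<in> ?S \<Longrightarrow> v d \<le> v e"
    using arg_min_if_finite(1)[of ?S v] arg_min_least[of ?S _ v] rel(1)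
    by (metis (no_types, lifting) Diff_iff finite.emptyI finite_Diff finite_insert empty_iff insert_iff)
  have "(r / d) *s x + (s / d) *s y + (t / d) *s z = (1 / d) *s (r *s x + s *s y + t *s z)"
    by (simp add: vec_eq_iff divide_inverse algebra_simps)
  also have "\<dots> = 0" using rel(2) by simp
  finally have rel': "(r / d) *s x + (s / d) *s y + (t / d) *s z = 0" .
  have "e / d \<in> \<oo>" if "e \<in> {r, s, t}" for e
    using d that by (cases "e = 0") (auto simp: O_divide_iff)
  moreover have "r / d = 1 \<or> s / d = 1 \<or> t / d = 1" using d(1) by auto
  ultimately show ?thesis using that[of "r / d" "s / d" "t / d"] rel' by blast
qed

text \<open>A submodule of a plane modulo a uniformizer has length at most two.\<close>

lemma rank_two_chain:
  fixes M1 M2 M3 :: "('a^2) set"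
  assumes sub: "o_submodule v (*s) M1" "o_submodule v (*s) M2" "o_submodule v (*s) M3"
    and chain: "M3 \<subset> M2" "M2 \<subset> M1"
    and p: "p \<noteq> 0" "v p = 1" "\<And>m. m \<in> M1 \<Longrightarrow> p *s m \<in> M3"
    and z: "z \<in> M3"
  shows "\<exists>w\<in>M1. z = p *s w"
proof -
  \<comment> \<open>\<open>x\<close> and \<open>y\<close> witness the strict inclusions. The plan is
    to show that neither can have a unit coefficient in a relation with \<open>z\<close>.\<close>
  obtain x y where x: "x \<in> M1" "x \<notin> M2" and y: "y \<in> M2" "y \<notin> M3" using chain by blast
  obtain r s t where rst: "r \<in> \<oo>" "s \<in> \<oo>" "t \<in> \<oo>" "r = 1 \<or> s = 1 \<or> t = 1"
    and rel: "r *s x + s *s y + t *s z = 0" by (rule linear_relation)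
  \<comment> \<open>An integral non-unit is divisible by the uniformizer.\<close>
  have small: "u / p \<in> \<oo>" if "u \<in> \<oo>" "\<not> (u \<noteq> 0 \<and> 1 / u \<in> \<oo>)" for u
    using that p by (auto simp: O_divide_iff O_iff[of "1/u"] O_iff[of u] v_divide v_1)
  have z2: "z \<in> M2" and y1: "y \<in> M1" using z y chain by auto
  have "r / p \<in> \<oo>"
  proof (rule small[OF rst(1)], rule notI)
    assume r: "r \<noteq> 0 \<and> 1 / r \<in> \<oo>"
    then have "x = (- s * (1 / r)) *s y + (- t * (1 / r)) *s z"
      using rel by (simp add: vec_eq_iff field_simps eq_neg_iff_add_eq_0 add.assoc)
    also have "\<dots> \<in> M2"
      using r rst y(1) z2 by (intro o_submoduleD[OF sub(2)] O_mult) auto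
    finally show False using x(2) by simp
  qed
  \<comment> \<open>Now \<open>r *s x\<close> is an integral multiple of \<open>p *s x\<close>,
    hence lies in \<open>M3\<close>; a unit \<open>s\<close> would put \<open>y\<close> there
    too.\<close>
  moreover have "s / p \<in> \<oo>"
  proof (rule small[OF rst(2)], rule notI)
    assume s: "s \<noteq> 0 \<and> 1 / s \<in> \<oo>"
    then have "y = (- (r / p) * (1 / s)) *s (p *s x) + (- t * (1 / s)) *s z"
      using rel p(1) by (simp add: vec_eq_iff field_simps eq_neg_iff_add_eq_0 add.assoc)
    also have "\<dots> \<in> M3"
      using s rst x(1) z \<open>r / p \<in> \<oo>\<close> by (intro o_submoduleD[OF sub(3)] O_mult p(3)) auto
    finally show False using y(2) by simp
  qed
  moreover have "1 / p \<notin> \<oo>" using p by (simp add: O_divide_iff v_1)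
  \<comment> \<open>Neither \<open>r\<close> nor \<open>s\<close> can be 1, so \<open>t\<close> is
    the normalised coefficient; the others are divisible by \<open>p\<close>, which is then factored
    out of \<open>z\<close>.\<close>
  ultimately have "t = 1" using rst(4) by auto
  then have "z = p *s ((- (r / p)) *s x + (- (s / p)) *s y)"
    using rel p(1) by (simp add: vec_eq_iff field_simps eq_neg_iff_add_eq_0 add.assoc)
  moreover have "(- (r / p)) *s x + (- (s / p)) *s y \<in> M1"
    using x(1) y1 \<open>r / p \<in> \<oo>\<close> \<open>s / p \<in> \<oo>\<close> by (intro o_submoduleD[OF sub(1)]) auto
  ultimately show ?thesis by blast
qed

end

section \<open>Two by two matrices, stabilisers and adjoints\<close>

lemma module_vector: "module ((*s) :: 'a::field \<Rightarrow> 'a^'n \<Rightarrow> 'a^'n)"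
  by unfold_locales (auto simp: vec_eq_iff algebra_simps)

lemma module_msc: "module (msc :: 'a::field \<Rightarrow> 'a^2^2 \<Rightarrow> 'a^2^2)"
  by unfold_locales (auto simp: vec_eq_iff msc_def algebra_simps)

lemma matrix_mult_2:
  fixes A B :: "'a::comm_ring_1^2^2"
  shows "(A ** B) $ i $ j = A $ i $ 1 * B $ 1 $ j + A $ i $ 2 * B $ 2 $ j"
  by (simp add: matrix_matrix_mult_def sum_2)

lemma matrix_vector_mult_2:
  fixes A :: "'a::comm_ring_1^2^2"
  shows "(A *v x) $ i = A $ i $ 1 * x $ 1 + A $ i $ 2 * x $ 2"
  by (simp add: matrix_vector_mult_def sum_2)

lemma msc_component: "msc r A $ i $ j = r * A $ i $ j"
  by (simp add: msc_def)

lemma msc_mult_left: "msc r A ** B = msc r (A ** B)"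
  and msc_mult_right: "A ** msc r B = msc r (A ** B)"
  by (simp_all add: vec_eq_iff msc_def matrix_mult_2 algebra_simps)

lemma trd_commute: "trd (A ** B) = trd (B ** A)" for A B :: "'a::field^2^2"
  by (simp add: trd_def sum_2 matrix_mult_2 algebra_simps)

text \<open>Scalars commute with matrices, so homothetic lattices share their stabiliser. The
  hypothesis is phrased by membership to suit duals, which are known through membership
  conditions.\<close>

lemma EndL_scale:
  assumes "z \<noteq> 0" "\<And>x. x \<in> L' \<longleftrightarrow> z *s x \<in> L"
  shows "EndL L' = EndL L"
proof -
  have "A *v x \<in> L" if A: "\<forall>x. z *s x \<in> L \<longrightarrow> z *s (A *v x) \<in> L" and "x \<in> L" for A x
    using A[rule_format, of "(1 / z) *s x"] that(2) assms(1) by (simp add: vector_scalar_commute)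
  moreover have "z *s (A *v x) \<in> L" if A: "\<forall>x\<in>L. A *v x \<in> L" and "z *s x \<in> L" for A x
    using A[rule_format, of "z *s x"] that(2) by (simp add: vector_scalar_commute)
  ultimately show ?thesis unfolding EndL_def by (auto simp: assms(2))
qed

context
  fixes J :: "'a::field^2^2 \<Rightarrow> 'a^2^2" and b :: "'a^2 \<Rightarrow> 'a^2 \<Rightarrow> 'a"
  assumes b: "adapted_form J b"
begin

lemma adapted_form_add: "b (x + y) z = b x z + b y z"
  by (rule b[unfolded adapted_form_def, THEN conjunct1, rule_format])

lemma adapted_form_scale: "b (r *s x) y = r * b x y"
  by (rule b[unfolded adapted_form_def, THEN conjunct2, THEN conjunct1, rule_format])

lemma adapted_form_sym: "b x y = b y x"
  by (rule b[unfolded adapted_form_def, THEN conjunct2, THEN conjunct2, THEN conjunct1, rule_format])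

lemma adapted_form_nondegenerate: "(\<And>y. b x y = 0) \<Longrightarrow> x = 0"
  by (rule b[unfolded adapted_form_def, THEN conjunct2, THEN conjunct2, THEN conjunct2,
        THEN conjunct1, rule_format])

lemma adapted_form_adjoint: "b x (A *v y) = b (J A *v x) y"
  by (rule b[unfolded adapted_form_def, THEN conjunct2, THEN conjunct2, THEN conjunct2,
        THEN conjunct2, rule_format])

lemma adapted_form_add_right: "b x (y + z) = b x y + b x z"
  by (metis adapted_form_sym adapted_form_add)

lemma adapted_form_scale_right: "b x (r *s y) = r * b x y"
  by (metis adapted_form_sym adapted_form_scale)

end

section \<open>The form of a ramified quadratic extension\<close>

text \<open>\<open>P\<close> carries coordinates to vectors and \<open>Q\<close> reads them off. The
  Gram matrix in this basis is \<open>c\<close> times the matrix with rows (1, \<xi>) and (\<xi>,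
  \<delta>), whose determinant \<open>\<delta> - \<xi>^2\<close> becomes \<open>lam\<close> in the
  theorem. Since 2 is not a unit, \<open>T^2 - 2 * \<xi> * T + \<delta>\<close> is an Eisenstein
  polynomial.\<close>

locale ramified_form = dval v for v :: "'a::field_char_0 \<Rightarrow> int" +
  fixes J :: "'a^2^2 \<Rightarrow> 'a^2^2" and b :: "'a^2 \<Rightarrow> 'a^2 \<Rightarrow> 'a"
    and c \<xi> \<delta> :: 'a and P Q :: "'a^2^2"
  assumes v2: "0 < v 2"
    and adapted: "adapted_form J b"
    and J_J: "J (J A) = A"
    and PQ: "P ** Q = mat 1" and QP: "Q ** P = mat 1"
    and c_nz: "c \<noteq> 0" and \<delta>_nz: "\<delta> \<noteq> 0" and v_\<delta>: "v \<delta> = 1" and \<xi>_int: "\<xi> \<in> vring v"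
    and b_eq: "b x y = c * ((Q *v x) $ 1 * (Q *v y) $ 1
      + \<xi> * ((Q *v x) $ 1 * (Q *v y) $ 2 + (Q *v x) $ 2 * (Q *v y) $ 1)
      + \<delta> * (Q *v x) $ 2 * (Q *v y) $ 2)"
begin

abbreviation X where "X x \<equiv> (Q *v x) $ 1"
abbreviation Y where "Y x \<equiv> (Q *v x) $ 2"

text \<open>With \<open>X\<close> and \<open>Y\<close> as coordinates for the basis 1, \<pi> of
  \<open>K\<close>, where \<pi> is a root of the Eisenstein polynomial, \<open>Lam 1\<close> is the
  ring of integers of \<open>K\<close> and \<open>Lam \<delta>\<close> its maximal ideal.\<close>

definition Lam :: "'a \<Rightarrow> ('a^2) set" where
  "Lam \<alpha> = {x. X x / \<alpha> \<in> \<oo> \<and> Y x \<in> \<oo>}"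

text \<open>Two parameters cover both kinds of order: \<beta> = 1/\<alpha> gives the stabiliser of
  \<open>Lam \<alpha>\<close>, while \<alpha> = \<delta>, \<beta> = 1 gives the Eichler
  order.\<close>

definition Rm :: "'a \<Rightarrow> 'a \<Rightarrow> ('a^2^2) set" where
  "Rm \<alpha> \<beta> = {A. (Q ** A ** P) $ 1 $ 1 \<in> \<oo> \<and> (Q ** A ** P) $ 1 $ 2 / \<alpha> \<in> \<oo> \<and>
      (Q ** A ** P) $ 2 $ 1 / \<beta> \<in> \<oo> \<and> (Q ** A ** P) $ 2 $ 2 \<in> \<oo>}"

lemma crd_add: "(Q *v (x + y)) $ i = (Q *v x) $ i + (Q *v y) $ i"
  and crd_scale: "(Q *v (r *s x)) $ i = r * (Q *v x) $ i"
  and crd_0: "(Q *v 0) $ i = 0"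
  by (simp_all add: matrix_vector_mult_2 algebra_simps)

lemma P_Q_vec: "P *v (Q *v x) = x" and Q_P_vec: "Q *v (P *v x) = x"
  by (simp_all add: matrix_vector_mul_assoc PQ QP)

lemma P_Q_mat: "P ** (Q ** A ** P) ** Q = A" and Q_P_mat: "Q ** (P ** A ** Q) ** P = A"
  by (metis PQ matrix_mul_assoc matrix_mul_lid matrix_mul_rid,
      metis QP matrix_mul_assoc matrix_mul_lid matrix_mul_rid)

lemma crd_matrix: "(Q *v (A *v x)) $ i =
    (Q ** A ** P) $ i $ 1 * X x + (Q ** A ** P) $ i $ 2 * Y x"
proof -
  have "Q *v (A *v x) = (Q ** A ** P) *v (Q *v x)"
    by (metis P_Q_vec matrix_vector_mul_assoc)
  then show ?thesis by (simp add: matrix_vector_mult_2)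
qed

lemma conj_mult: "Q ** (A ** B) ** P = (Q ** A ** P) ** (Q ** B ** P)"
  by (metis PQ matrix_mul_assoc matrix_mul_rid)

lemma conj_mult_component: "(Q ** (A ** B) ** P) $ i $ j =
    (Q ** A ** P) $ i $ 1 * (Q ** B ** P) $ 1 $ j + (Q ** A ** P) $ i $ 2 * (Q ** B ** P) $ 2 $ j"
  by (subst conj_mult, rule matrix_mult_2)

lemma conj_add: "Q ** (A + B) ** P = Q ** A ** P + Q ** B ** P"
  by (simp add: vec_eq_iff matrix_mult_2 algebra_simps)

lemma conj_msc: "Q ** msc r A ** P = msc r (Q ** A ** P)"
  by (simp add: msc_mult_left msc_mult_right)

lemma conj_0: "Q ** 0 ** P = 0"
  by (simp add: vec_eq_iff matrix_mult_2)

lemmas b_add = adapted_form_add[OF adapted]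
  and b_scale = adapted_form_scale[OF adapted]
  and b_add_right = adapted_form_add_right[OF adapted]
  and b_scale_right = adapted_form_scale_right[OF adapted]
  and b_sym = adapted_form_sym[OF adapted]
  and b_adj = adapted_form_adjoint[OF adapted]
  and b_nondeg = adapted_form_nondegenerate[OF adapted]

definition vec_of :: "'a \<Rightarrow> 'a \<Rightarrow> 'a^2" where
  "vec_of r s = P *v vector [r, s]"

lemma crd_vec_of [simp]: "X (vec_of r s) = r" "Y (vec_of r s) = s"
  by (simp_all add: vec_of_def Q_P_vec)

lemma vec_eqI:
  assumes "X x = X y" "Y x = Y y"
  shows "x = y"
proof -
  have "Q *v x = Q *v y" using assms by (simp add: vec_eq_iff forall_2)
  then show ?thesis by (metis P_Q_vec)
qed

definition mat_of :: "'a \<Rightarrow> 'a \<Rightarrow> 'a \<Rightarrow> 'a \<Rightarrow> 'a^2^2" where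
  "mat_of p q r s = P ** vector [vector [p, q], vector [r, s]] ** Q"

lemma conj_mat_of [simp]: "Q ** mat_of p q r s ** P = vector [vector [p, q], vector [r, s]]"
  by (simp add: mat_of_def Q_P_mat)

lemma mat_eqI:
  assumes "\<And>i j. (Q ** A ** P) $ i $ j = (Q ** B ** P) $ i $ j"
  shows "A = B"
proof -
  have "Q ** A ** P = Q ** B ** P" using assms by (simp add: vec_eq_iff)
  then show ?thesis by (metis P_Q_mat)
qed

lemma lattice_Lam:
  assumes "\<alpha> \<noteq> 0"
  shows "vlattice v (Lam \<alpha>)" "o_submodule v (*s) (Lam \<alpha>)"
proof -
  show sub: "o_submodule v (*s) (Lam \<alpha>)"
    unfolding o_submodule_def Lam_def
    by (auto simp: crd_add crd_scale crd_0 add_divide_distrib intro: O_add O_mult simp flip: times_divide_eq_right)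
  show "vlattice v (Lam \<alpha>)"
    unfolding vlattice_def
  proof (rule o_latticeI[OF module_vector sub, of "{vec_of \<alpha> 0, vec_of 0 1}"])
    show "{vec_of \<alpha> 0, vec_of 0 1} \<subseteq> Lam \<alpha>" using assms by (auto simp: Lam_def)
    show "Lam \<alpha> \<subseteq> o_gen v (*s) {vec_of \<alpha> 0, vec_of 0 1}"
    proof
      fix x assume x: "x \<in> Lam \<alpha>"
      have "x = (X x / \<alpha>) *s vec_of \<alpha> 0 + Y x *s vec_of 0 1"
        using assms by (intro vec_eqI) (simp_all add: crd_add crd_scale)
      also have "\<dots> \<in> o_gen v (*s) {vec_of \<alpha> 0, vec_of 0 1}"
        using x by (intro o_submoduleD[OF o_gen_submodule[OF module_vector]] o_gen_base[OF module_vector])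
          (auto simp: Lam_def)
      finally show "x \<in> o_gen v (*s) {vec_of \<alpha> 0, vec_of 0 1}" .
    qed
    show "\<exists>d. d \<noteq> 0 \<and> d *s x \<in> Lam \<alpha>" for x
      using common_denominator[of "{X x / \<alpha>, Y x}"] by (auto simp: Lam_def crd_scale)
  qed auto
qed

lemma order_Rm:
  assumes "\<alpha> \<noteq> 0" "\<beta> \<noteq> 0" "\<alpha> * \<beta> \<in> \<oo>"
  shows "is_order v (Rm \<alpha> \<beta>)"
  unfolding is_order_def
proof (intro conjI ballI)
  let ?S = "{mat_of 1 0 0 0, mat_of 0 \<alpha> 0 0, mat_of 0 0 \<beta> 0, mat_of 0 0 0 1}"
  have sub: "o_submodule v msc (Rm \<alpha> \<beta>)"
    unfolding o_submodule_def Rm_def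
    by (auto simp: conj_add conj_msc conj_0 msc_component add_divide_distrib intro: O_add O_mult
        simp flip: times_divide_eq_right)
  show "o_lattice v msc (Rm \<alpha> \<beta>)"
  proof (rule o_latticeI[OF module_msc sub, of ?S])
    show "?S \<subseteq> Rm \<alpha> \<beta>" using assms by (auto simp: Rm_def)
    show "Rm \<alpha> \<beta> \<subseteq> o_gen v msc ?S"
    proof
      fix A assume A: "A \<in> Rm \<alpha> \<beta>"
      let ?B = "Q ** A ** P"
      have "A = msc (?B $ 1 $ 1) (mat_of 1 0 0 0) + msc (?B $ 1 $ 2 / \<alpha>) (mat_of 0 \<alpha> 0 0)
          + msc (?B $ 2 $ 1 / \<beta>) (mat_of 0 0 \<beta> 0) + msc (?B $ 2 $ 2) (mat_of 0 0 0 1)"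
      proof (rule mat_eqI)
        fix i j :: 2
        show "?B $ i $ j = (Q ** (msc (?B $ 1 $ 1) (mat_of 1 0 0 0) + msc (?B $ 1 $ 2 / \<alpha>) (mat_of 0 \<alpha> 0 0)
          + msc (?B $ 2 $ 1 / \<beta>) (mat_of 0 0 \<beta> 0) + msc (?B $ 2 $ 2) (mat_of 0 0 0 1)) ** P) $ i $ j"
          using assms exhaust_2[of i] exhaust_2[of j]
          by (auto simp: conj_add conj_msc msc_component)
      qed
      also have "\<dots> \<in> o_gen v msc ?S"
        using A by (intro o_submoduleD[OF o_gen_submodule[OF module_msc]] o_gen_base[OF module_msc])
          (auto simp: Rm_def)
      finally show "A \<in> o_gen v msc ?S" .
    qed
    show "\<exists>d. d \<noteq> 0 \<and> msc d A \<in> Rm \<alpha> \<beta>" for A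
      using common_denominator[of "{(Q ** A ** P) $ 1 $ 1, (Q ** A ** P) $ 1 $ 2 / \<alpha>,
          (Q ** A ** P) $ 2 $ 1 / \<beta>, (Q ** A ** P) $ 2 $ 2}"]
      unfolding Rm_def by (auto simp: conj_msc msc_component)
  qed auto
  have "Q ** mat 1 ** P = mat 1" by (simp add: QP)
  then show "mat 1 \<in> Rm \<alpha> \<beta>" by (simp add: Rm_def mat_def)
  fix A B assume "A \<in> Rm \<alpha> \<beta>" "B \<in> Rm \<alpha> \<beta>"
  \<comment> \<open>Extracting \<alpha> and \<beta> from the off-diagonal entries shows that only
    the product \<open>\<alpha> * \<beta>\<close> enters the diagonal of a product of
    matrices.\<close>
  moreover have "\<exists>a a'. (Q ** A ** P) $ 1 $ 1 \<in> \<oo> \<and> (Q ** A ** P) $ 1 $ 2 = \<alpha> * a \<and> a \<in> \<oo> \<and>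
      (Q ** A ** P) $ 2 $ 1 = \<beta> * a' \<and> a' \<in> \<oo> \<and> (Q ** A ** P) $ 2 $ 2 \<in> \<oo>"
    if "A \<in> Rm \<alpha> \<beta>" for A
    using that assms
    by (intro exI[of _ "(Q ** A ** P) $ 1 $ 2 / \<alpha>"] exI[of _ "(Q ** A ** P) $ 2 $ 1 / \<beta>"])
      (simp add: Rm_def)
  ultimately obtain a a' b b' where
    A: "(Q ** A ** P) $ 1 $ 1 \<in> \<oo>" "(Q ** A ** P) $ 1 $ 2 = \<alpha> * a" "a \<in> \<oo>"
      "(Q ** A ** P) $ 2 $ 1 = \<beta> * a'" "a' \<in> \<oo>" "(Q ** A ** P) $ 2 $ 2 \<in> \<oo>"
    and B: "(Q ** B ** P) $ 1 $ 1 \<in> \<oo>" "(Q ** B ** P) $ 1 $ 2 = \<alpha> * b" "b \<in> \<oo>"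
      "(Q ** B ** P) $ 2 $ 1 = \<beta> * b'" "b' \<in> \<oo>" "(Q ** B ** P) $ 2 $ 2 \<in> \<oo>"
    by meson
  let ?A = "Q ** A ** P" and ?B = "Q ** B ** P"
  have "?A $ 1 $ 1 * ?B $ 1 $ 1 + (\<alpha> * \<beta>) * (a * b') \<in> \<oo>"
    "?A $ 1 $ 1 * b + a * ?B $ 2 $ 2 \<in> \<oo>" "a' * ?B $ 1 $ 1 + ?A $ 2 $ 2 * b' \<in> \<oo>"
    "(\<alpha> * \<beta>) * (a' * b) + ?A $ 2 $ 2 * ?B $ 2 $ 2 \<in> \<oo>"
    by (intro O_add O_mult A B assms)+
  moreover have "(Q ** (A ** B) ** P) $ 1 $ 1 = ?A $ 1 $ 1 * ?B $ 1 $ 1 + (\<alpha> * \<beta>) * (a * b')"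
    "(Q ** (A ** B) ** P) $ 1 $ 2 / \<alpha> = ?A $ 1 $ 1 * b + a * ?B $ 2 $ 2"
    "(Q ** (A ** B) ** P) $ 2 $ 1 / \<beta> = a' * ?B $ 1 $ 1 + ?A $ 2 $ 2 * b'"
    "(Q ** (A ** B) ** P) $ 2 $ 2 = (\<alpha> * \<beta>) * (a' * b) + ?A $ 2 $ 2 * ?B $ 2 $ 2"
    unfolding conj_mult_component A(2,4) B(2,4) using assms by (simp_all add: field_simps)
  ultimately show "A ** B \<in> Rm \<alpha> \<beta>"
    unfolding Rm_def by simp
qed

lemma EndL_Lam:
  assumes "\<alpha> \<noteq> 0"
  shows "EndL (Lam \<alpha>) = Rm \<alpha> (1 / \<alpha>)"
proof
  show "Rm \<alpha> (1 / \<alpha>) \<subseteq> EndL (Lam \<alpha>)"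
  proof
    fix A assume A: "A \<in> Rm \<alpha> (1 / \<alpha>)"
    let ?B = "Q ** A ** P"
    show "A \<in> EndL (Lam \<alpha>)"
      unfolding EndL_def
    proof (intro CollectI ballI)
      fix x assume x: "x \<in> Lam \<alpha>"
      have "X (A *v x) / \<alpha> = ?B $ 1 $ 1 * (X x / \<alpha>) + (?B $ 1 $ 2 / \<alpha>) * Y x"
        by (simp add: crd_matrix add_divide_distrib)
      also have "\<dots> \<in> \<oo>"
        by (intro O_add O_mult) (use A x in \<open>auto simp: Rm_def Lam_def\<close>)
      finally have 1: "X (A *v x) / \<alpha> \<in> \<oo>" .
      have "Y (A *v x) = (?B $ 2 $ 1 / (1 / \<alpha>)) * (X x / \<alpha>) + ?B $ 2 $ 2 * Y x"
        using assms by (simp add: crd_matrix)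
      also have "\<dots> \<in> \<oo>"
        by (intro O_add O_mult) (use A x in \<open>auto simp: Rm_def Lam_def\<close>)
      finally show "A *v x \<in> Lam \<alpha>" using 1 by (simp add: Lam_def)
    qed
  qed
  show "EndL (Lam \<alpha>) \<subseteq> Rm \<alpha> (1 / \<alpha>)"
  proof
    fix A assume A: "A \<in> EndL (Lam \<alpha>)"
    have "vec_of \<alpha> 0 \<in> Lam \<alpha>" "vec_of 0 1 \<in> Lam \<alpha>" using assms by (auto simp: Lam_def)
    with A have "A *v vec_of \<alpha> 0 \<in> Lam \<alpha>" "A *v vec_of 0 1 \<in> Lam \<alpha>" by (auto simp: EndL_def)
    with assms show "A \<in> Rm \<alpha> (1 / \<alpha>)" by (auto simp: Lam_def Rm_def crd_matrix)
  qed
qed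

text \<open>At each off-diagonal entry the stricter condition survives: \<open>Lam \<delta>\<close>
  governs the upper right one and \<open>Lam 1\<close> the lower left one.\<close>

lemma EndL_Lam_Int: "EndL (Lam 1) \<inter> EndL (Lam \<delta>) = Rm \<delta> 1"
proof -
  have "\<delta> \<in> \<oo>" using v_\<delta> by (simp add: O_iff)
  then have "x \<in> \<oo>" if "x / \<delta> \<in> \<oo>" for x using O_mult[OF that, of \<delta>] \<delta>_nz by simp
  moreover have "x * \<delta> \<in> \<oo>" if "x \<in> \<oo>" for x using that \<open>\<delta> \<in> \<oo>\<close> by (rule O_mult)
  ultimately show ?thesis
    unfolding EndL_Lam[OF \<delta>_nz] EndL_Lam[OF one_neq_zero] by (auto simp: Rm_def)
qed


section \<open>Values of the Eisenstein form\<close>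

lemma Lam_mem: "x \<in> Lam \<alpha> \<longleftrightarrow> X x / \<alpha> \<in> \<oo> \<and> Y x \<in> \<oo>"
  by (simp add: Lam_def)

lemma \<delta>_int: "\<delta> \<in> \<oo>" and inverse_\<delta>_not_int: "1 / \<delta> \<notin> \<oo>"
  using v_\<delta> O_divide_iff[OF \<delta>_nz, of 1] by (auto simp: O_iff[of \<delta>] v_1)

lemma int_iff_unit_mult: "u \<noteq> 0 \<Longrightarrow> v u = 0 \<Longrightarrow> u * x \<in> \<oo> \<longleftrightarrow> x \<in> \<oo>"
  by (cases "x = 0") (auto simp: O_iff v_mult)

text \<open>No cancellation occurs, since \<delta> has valuation 1 and \<open>\<xi>^2\<close> is
  zero or has even valuation. The cases separate lattices that are self-dual up to scaling from
  lattices that duality exchanges.\<close>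

lemma ramified_cases:
  obtains (unit) "\<xi> \<noteq> 0" "v \<xi> = 0" "\<delta> - \<xi>^2 \<noteq> 0" "v (\<delta> - \<xi>^2) = 0"
  | (uniformizer) "\<xi> / \<delta> \<in> \<oo>" "\<delta> - \<xi>^2 \<noteq> 0" "v (\<delta> - \<xi>^2) = 1"
proof (cases "\<xi> \<noteq> 0 \<and> v \<xi> = 0")
  case True
  then have "- (\<xi>^2) + \<delta> \<noteq> 0 \<and> v (- (\<xi>^2) + \<delta>) = v (- (\<xi>^2))"
    using v_\<delta> by (intro v_add_strict) (auto simp: v_minus v_power)
  with True show ?thesis by (intro unit) (auto simp: v_minus v_power)
next
  case False
  then have "\<xi> = 0 \<or> 1 \<le> v \<xi>" using \<xi>_int by (auto simp: O_iff)
  moreover from this have "\<delta> + - (\<xi>^2) \<noteq> 0 \<and> v (\<delta> + - (\<xi>^2)) = v \<delta>"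
    using v_\<delta> \<delta>_nz by (cases "\<xi> = 0"; intro v_add_strict; simp add: v_minus v_power)
  ultimately show ?thesis
    using v_\<delta> \<delta>_nz by (intro uniformizer) (auto simp: O_divide_iff)
qed

lemma two_divisible: "2 / \<delta> \<in> \<oo>"
  using v2 v_\<delta> \<delta>_nz by (simp add: O_divide_iff)

text \<open>The three terms have valuations \<open>2 v x\<close>, at least \<open>v x + v y + 1\<close>, and \<open>2 v y + 1\<close>; the
  first and last have different parity, and the middle one exceeds their average.\<close>

lemma eisenstein_form_valuation:
  assumes k: "k \<le> 1" "x^2 + 2 * \<xi> * x * y + \<delta> * y^2 = 0 \<or> k \<le> v (x^2 + 2 * \<xi> * x * y + \<delta> * y^2)"
  shows "(x = 0 \<or> k \<le> 2 * v x) \<and> (y = 0 \<or> k \<le> 2 * v y + 1)"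
proof (cases "x = 0 \<or> y = 0")
  case True
  then show ?thesis
    using k \<delta>_nz v_\<delta> by (cases "x = 0"; cases "y = 0"; simp add: v_mult v_power)
next
  case False
  let ?m = "2 * \<xi> * x * y"
  have vx: "v (x^2) = 2 * v x" and vy: "v (\<delta> * y^2) = 2 * v y + 1"
    using False \<delta>_nz v_\<delta> by (auto simp: v_mult v_power)
  have m: "?m = 0 \<or> v x + v y + 1 \<le> v ?m"
    using False \<xi>_int v2 by (cases "\<xi> = 0"; simp add: v_mult O_iff)
  have sum: "s = 0 \<or> t = 0 \<or> s + t = 0 \<or> min (v s) (v t) \<le> v (s + t)" for s t
    using v_add[of s t] by blast
  show ?thesis
  proof (cases "v x \<le> v y")
    case True
    have "?m + \<delta> * y^2 = 0 \<or> v (x^2) < v (?m + \<delta> * y^2)"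
      using sum[of ?m "\<delta> * y^2"] m vx vy True by auto
    then have "x^2 + (?m + \<delta> * y^2) \<noteq> 0 \<and> v (x^2 + (?m + \<delta> * y^2)) = v (x^2)"
      using False by (intro v_add_strict) auto
    with k vx True show ?thesis by (auto simp: add.assoc)
  next
    case False': False
    have "?m + x^2 = 0 \<or> v (\<delta> * y^2) < v (?m + x^2)"
      using sum[of ?m "x^2"] m vx vy False' by auto
    then have "\<delta> * y^2 + (?m + x^2) \<noteq> 0 \<and> v (\<delta> * y^2 + (?m + x^2)) = v (\<delta> * y^2)"
      using False \<delta>_nz by (intro v_add_strict) auto
    moreover have "\<delta> * y^2 + (?m + x^2) = x^2 + ?m + \<delta> * y^2" by simp
    ultimately show ?thesis using k vy False' by auto
  qed
qed

lemma b_self: "b x x = c * ((X x)^2 + 2 * \<xi> * X x * Y x + \<delta> * (Y x)^2)"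
  by (simp add: b_eq power2_eq_square algebra_simps)

text \<open>In the basis \<open>vec_of \<alpha> 0\<close>, \<open>vec_of 0 1\<close> the Gram matrix
  divided by \<open>c * \<alpha>\<close> has entries \<alpha>, \<xi>, \<xi> and \<delta>/\<alpha>,
  all integral because \<alpha> divides \<delta>.\<close>

lemma b_Lam:
  assumes "\<alpha> \<in> {1, \<delta>}" "x \<in> Lam \<alpha>" "y \<in> Lam \<alpha>"
  shows "b x y / (c * \<alpha>) \<in> \<oo>"
proof -
  have "\<alpha> \<noteq> 0" "\<alpha> \<in> \<oo>" "\<delta> / \<alpha> \<in> \<oo>" using assms(1) \<delta>_nz \<delta>_int by auto
  then have "b x y / (c * \<alpha>) = \<alpha> * (X x / \<alpha>) * (X y / \<alpha>)
      + \<xi> * ((X x / \<alpha>) * Y y + Y x * (X y / \<alpha>)) + \<delta> / \<alpha> * Y x * Y y"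
    using c_nz by (simp add: b_eq field_simps)
  also have "\<dots> \<in> \<oo>"
    by (intro O_add O_mult \<xi>_int \<open>\<alpha> \<in> \<oo>\<close> \<open>\<delta> / \<alpha> \<in> \<oo>\<close>) (use assms in \<open>auto simp: Lam_mem\<close>)
  finally show ?thesis .
qed

lemma Lam_iff:
  assumes "\<alpha> \<in> {1, \<delta>}"
  shows "x \<in> Lam \<alpha> \<longleftrightarrow> b x x / (c * \<alpha>) \<in> \<oo>"
proof
  assume *: "b x x / (c * \<alpha>) \<in> \<oo>"
  have "\<alpha> \<noteq> 0" "v \<alpha> = 0 \<or> v \<alpha> = 1" using assms \<delta>_nz v_\<delta> v_1 by auto
  moreover have "b x x / (c * \<alpha>) = ((X x)^2 + 2 * \<xi> * X x * Y x + \<delta> * (Y x)^2) / \<alpha>"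
    using c_nz by (simp add: b_self)
  ultimately have "(X x = 0 \<or> v \<alpha> \<le> 2 * v (X x)) \<and> (Y x = 0 \<or> v \<alpha> \<le> 2 * v (Y x) + 1)"
    using * by (intro eisenstein_form_valuation) (auto simp: O_divide_iff)
  moreover have "Y x \<in> \<oo> \<longleftrightarrow> Y x = 0 \<or> 0 \<le> v (Y x)" by (rule O_iff)
  \<comment> \<open>Rounding in the integers: as \<open>v \<alpha>\<close> is 0 or 1, the bound on
    \<open>2 * v (X x)\<close> gives the same bound on \<open>v (X x)\<close>, and the bound on
    \<open>2 * v (Y x) + 1\<close> makes \<open>v (Y x)\<close> nonnegative.\<close>
  ultimately show "x \<in> Lam \<alpha>"
    using \<open>\<alpha> \<noteq> 0\<close> \<open>v \<alpha> = 0 \<or> v \<alpha> = 1\<close> by (auto simp: Lam_mem O_divide_iff)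
qed (use b_Lam[OF assms] in blast)

text \<open>By \<open>Lam_iff\<close>, \<open>Lam \<alpha>\<close> holds every vector whose value
  lies in the ideal, so it contains every lattice competing with it.\<close>

lemma a_maximal_Lam:
  assumes "\<alpha> \<in> {1, \<delta>}"
  shows "a_maximal v b {c * \<alpha> * r | r. r \<in> \<oo>} (Lam \<alpha>)"
proof -
  have nz: "\<alpha> \<noteq> 0" "c * \<alpha> \<noteq> 0" using assms \<delta>_nz c_nz by auto
  have "norm_ideal v b (Lam \<alpha>) \<subseteq> {c * \<alpha> * r | r. r \<in> \<oo>}"
    unfolding norm_ideal_def
    by (rule o_gen_subset[OF principal_submodule])
      (use Lam_iff[OF assms] in \<open>auto simp: principal_ideal_eq[OF nz(2)]\<close>)
  moreover have "L \<subseteq> Lam \<alpha>" if "norm_ideal v b L \<subseteq> {c * \<alpha> * r | r. r \<in> \<oo>}" for L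
  proof
    fix x assume "x \<in> L"
    have "module ((*) :: 'a \<Rightarrow> 'a \<Rightarrow> 'a)" by unfold_locales (auto simp: algebra_simps)
    with \<open>x \<in> L\<close> have "b x x \<in> norm_ideal v b L"
      unfolding norm_ideal_def by (intro o_gen_base) auto
    with that show "x \<in> Lam \<alpha>"
      unfolding principal_ideal_eq[OF nz(2)] Lam_iff[OF assms] by blast
  qed
  ultimately show ?thesis
    using lattice_Lam(1)[OF nz(1)] unfolding a_maximal_def by blast
qed

section \<open>Duals of the two lattices\<close>

text \<open>Duality for the normalised form \<open>b / c\<close>; this is \<open>c\<close> times
  \<open>dual_lat v b L\<close>, hence has the same stabiliser.\<close>

definition D :: "('a^2) set \<Rightarrow> ('a^2) set" where
  "D L = {x. \<forall>y\<in>L. b x y / c \<in> \<oo>}"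

lemma D_submodule: "o_submodule v (*s) (D L)"
proof -
  have "b 0 y = 0" for y using b_scale[of 0 0 y] by simp
  then show ?thesis
    unfolding o_submodule_def D_def
    by (auto simp: b_add b_scale add_divide_distrib intro: O_add O_mult simp flip: times_divide_eq_right)
qed

lemma D_antimono: "L \<subseteq> L' \<Longrightarrow> D L' \<subseteq> D L"
  by (auto simp: D_def)

lemma J_EndL_D: "A \<in> EndL L \<Longrightarrow> J A \<in> EndL (D L)"
  by (auto simp: EndL_def D_def simp flip: b_adj)

lemma EndL_dual_lat: "EndL (dual_lat v b L) = EndL (D L)"
  by (rule EndL_scale[OF c_nz]) (simp add: dual_lat_def D_def b_scale c_nz)

text \<open>The two conditions are the pairings with the basis \<open>vec_of \<alpha> 0\<close>,
  \<open>vec_of 0 1\<close> of \<open>Lam \<alpha>\<close>.\<close>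

lemma D_Lam:
  assumes "\<alpha> \<noteq> 0"
  shows "x \<in> D (Lam \<alpha>) \<longleftrightarrow> \<alpha> * (X x + \<xi> * Y x) \<in> \<oo> \<and> \<xi> * X x + \<delta> * Y x \<in> \<oo>"
proof
  assume "x \<in> D (Lam \<alpha>)"
  moreover have "vec_of \<alpha> 0 \<in> Lam \<alpha>" "vec_of 0 1 \<in> Lam \<alpha>" using assms by (auto simp: Lam_mem)
  ultimately have "b x (vec_of \<alpha> 0) / c \<in> \<oo>" "b x (vec_of 0 1) / c \<in> \<oo>" by (auto simp: D_def)
  moreover have "b x (vec_of \<alpha> 0) / c = \<alpha> * (X x + \<xi> * Y x)"
    "b x (vec_of 0 1) / c = \<xi> * X x + \<delta> * Y x"
    using c_nz by (simp_all add: b_eq) (simp add: algebra_simps)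
  ultimately show "\<alpha> * (X x + \<xi> * Y x) \<in> \<oo> \<and> \<xi> * X x + \<delta> * Y x \<in> \<oo>" by simp
next
  assume *: "\<alpha> * (X x + \<xi> * Y x) \<in> \<oo> \<and> \<xi> * X x + \<delta> * Y x \<in> \<oo>"
  show "x \<in> D (Lam \<alpha>)"
    unfolding D_def
  proof (intro CollectI ballI)
    fix y assume y: "y \<in> Lam \<alpha>"
    have "b x y / c = \<alpha> * (X x + \<xi> * Y x) * (X y / \<alpha>) + (\<xi> * X x + \<delta> * Y x) * Y y"
      using assms c_nz by (simp add: b_eq field_simps)
    also have "\<dots> \<in> \<oo>"
      by (rule O_add[OF O_mult O_mult]) (use * y in \<open>auto simp: Lam_mem\<close>)
    finally show "b x y / c \<in> \<oo>" .
  qed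
qed

text \<open>The Gram determinant \<open>\<delta> - \<xi>^2\<close> is a unit, so
  \<open>Lam 1\<close> is unimodular for \<open>b / c\<close>. On \<open>Lam \<delta>\<close> the
  Gram matrix is \<delta> times one with that same determinant, which makes the dual a multiple of
  \<open>Lam \<delta>\<close>.\<close>

lemma D_Lam_unit:
  assumes "\<xi> \<noteq> 0" "v \<xi> = 0" "\<delta> - \<xi>^2 \<noteq> 0" "v (\<delta> - \<xi>^2) = 0"
  shows "D (Lam 1) = Lam 1" "x \<in> D (Lam \<delta>) \<longleftrightarrow> \<delta> *s x \<in> Lam \<delta>"
proof -
  show "D (Lam 1) = Lam 1"
  proof (rule set_eqI)
    fix x
    let ?u = "X x + \<xi> * Y x" and ?w = "\<xi> * X x + \<delta> * Y x"
    have "X x \<in> \<oo> \<and> Y x \<in> \<oo>" if "?u \<in> \<oo>" "?w \<in> \<oo>"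
    proof
      \<comment> \<open>Cramer's rule: eliminating \<open>Y x\<close> from the two pairings leaves
        the determinant times \<open>X x\<close>.\<close>
      have "(\<delta> - \<xi>^2) * X x = \<delta> * ?u - \<xi> * ?w" by (simp add: power2_eq_square algebra_simps)
      also have "\<dots> \<in> \<oo>" by (intro O_diff O_mult that \<delta>_int \<xi>_int)
      finally show 1: "X x \<in> \<oo>" using assms by (simp add: int_iff_unit_mult)
      have "\<xi> * Y x = ?u - X x" by simp
      also have "\<dots> \<in> \<oo>" by (intro O_diff that 1)
      finally show "Y x \<in> \<oo>" using assms by (simp add: int_iff_unit_mult)
    qed
    moreover have "?u \<in> \<oo>" "?w \<in> \<oo>" if "X x \<in> \<oo>" "Y x \<in> \<oo>"
      by (intro O_add O_mult that \<delta>_int \<xi>_int)+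
    ultimately show "x \<in> D (Lam 1) \<longleftrightarrow> x \<in> Lam 1" by (auto simp: D_Lam Lam_mem)
  qed
  let ?u = "\<delta> * (X x + \<xi> * Y x)" and ?w = "\<xi> * X x + \<delta> * Y x"
  have "X x \<in> \<oo> \<and> \<delta> * Y x \<in> \<oo>" if "?u \<in> \<oo>" "?w \<in> \<oo>"
  proof
    have "(\<delta> - \<xi>^2) * X x = ?u - \<xi> * ?w" by (simp add: power2_eq_square algebra_simps)
    also have "\<dots> \<in> \<oo>" by (intro O_diff O_mult that \<xi>_int)
    finally show 1: "X x \<in> \<oo>" using assms by (simp add: int_iff_unit_mult)
    have "\<delta> * Y x = ?w - \<xi> * X x" by simp
    also have "\<dots> \<in> \<oo>" by (intro O_diff O_mult that 1 \<xi>_int)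
    finally show "\<delta> * Y x \<in> \<oo>" .
  qed
  moreover have "?u \<in> \<oo>" "?w \<in> \<oo>" if "X x \<in> \<oo>" "\<delta> * Y x \<in> \<oo>"
  proof -
    have "?u = \<delta> * X x + \<xi> * (\<delta> * Y x)" by (simp add: algebra_simps)
    also have "\<dots> \<in> \<oo>" by (intro O_add O_mult that \<delta>_int \<xi>_int)
    finally show "?u \<in> \<oo>" .
    show "?w \<in> \<oo>" by (intro O_add O_mult that \<xi>_int)
  qed
  ultimately show "x \<in> D (Lam \<delta>) \<longleftrightarrow> \<delta> *s x \<in> Lam \<delta>"
    using \<delta>_nz by (auto simp: D_Lam Lam_mem crd_scale)
qed

text \<open>The determinant is now a uniformizer and \<xi> is divisible by \<delta>. The same
  elimination, with one factor \<delta> cancelled, shows that duality exchanges the two lattices up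
  to scaling.\<close>

lemma D_Lam_uniformizer:
  assumes "\<xi> / \<delta> \<in> \<oo>" "\<delta> - \<xi>^2 \<noteq> 0" "v (\<delta> - \<xi>^2) = 1"
  shows "x \<in> D (Lam 1) \<longleftrightarrow> \<delta> *s x \<in> Lam \<delta>" "x \<in> D (Lam \<delta>) \<longleftrightarrow> \<delta> *s x \<in> Lam 1"
proof -
  have unit: "(\<delta> - \<xi>^2) / \<delta> \<noteq> 0" "v ((\<delta> - \<xi>^2) / \<delta>) = 0"
    using assms \<delta>_nz v_\<delta> by (auto simp: v_divide)
  let ?u = "X x + \<xi> * Y x" and ?w = "\<xi> * X x + \<delta> * Y x"
  have "X x \<in> \<oo> \<and> \<delta> * Y x \<in> \<oo>" if "?u \<in> \<oo>" "?w \<in> \<oo>"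
  proof
    have "(\<delta> - \<xi>^2) / \<delta> * X x = ?u - \<xi> / \<delta> * ?w"
      using \<delta>_nz by (simp add: power2_eq_square field_simps)
    also have "\<dots> \<in> \<oo>" by (intro O_diff O_mult that assms(1))
    finally show 1: "X x \<in> \<oo>" using unit int_iff_unit_mult by blast
    have "\<delta> * Y x = ?w - \<xi> * X x" by simp
    also have "\<dots> \<in> \<oo>" by (intro O_diff O_mult that 1 \<xi>_int)
    finally show "\<delta> * Y x \<in> \<oo>" .
  qed
  moreover have "?u \<in> \<oo>" "?w \<in> \<oo>" if "X x \<in> \<oo>" "\<delta> * Y x \<in> \<oo>"
  proof -
    have "?u = X x + \<xi> / \<delta> * (\<delta> * Y x)" using \<delta>_nz by simp
    also have "\<dots> \<in> \<oo>" by (intro O_add O_mult that assms(1))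
    finally show "?u \<in> \<oo>" .
    show "?w \<in> \<oo>" by (intro O_add O_mult that \<xi>_int)
  qed
  ultimately show "x \<in> D (Lam 1) \<longleftrightarrow> \<delta> *s x \<in> Lam \<delta>"
    using \<delta>_nz by (auto simp: D_Lam Lam_mem crd_scale)
  have "\<delta> * X x \<in> \<oo> \<and> \<delta> * Y x \<in> \<oo>" if "\<delta> * ?u \<in> \<oo>" "?w \<in> \<oo>"
  proof
    have "(\<delta> - \<xi>^2) / \<delta> * (\<delta> * X x) = \<delta> * ?u - \<xi> * ?w"
      using \<delta>_nz by (simp add: power2_eq_square field_simps)
    also have "\<dots> \<in> \<oo>" by (intro O_diff O_mult that \<xi>_int)
    finally show 1: "\<delta> * X x \<in> \<oo>" using unit int_iff_unit_mult by blast
    have "\<delta> * Y x = ?w - \<xi> / \<delta> * (\<delta> * X x)" using \<delta>_nz by simp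
    also have "\<dots> \<in> \<oo>" by (intro O_diff O_mult that 1 assms(1))
    finally show "\<delta> * Y x \<in> \<oo>" .
  qed
  moreover have "\<delta> * ?u \<in> \<oo>" "?w \<in> \<oo>" if "\<delta> * X x \<in> \<oo>" "\<delta> * Y x \<in> \<oo>"
  proof -
    have "\<delta> * ?u = \<delta> * X x + \<xi> * (\<delta> * Y x)" by (simp add: algebra_simps)
    also have "\<dots> \<in> \<oo>" by (intro O_add O_mult that \<xi>_int)
    finally show "\<delta> * ?u \<in> \<oo>" .
    have "?w = \<xi> / \<delta> * (\<delta> * X x) + \<delta> * Y x" using \<delta>_nz by simp
    also have "\<dots> \<in> \<oo>" by (intro O_add O_mult that assms(1))
    finally show "?w \<in> \<oo>" .
  qed
  ultimately show "x \<in> D (Lam \<delta>) \<longleftrightarrow> \<delta> *s x \<in> Lam 1"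
    using \<delta>_nz by (auto simp: D_Lam Lam_mem crd_scale)
qed

lemma EndL_D_Lam_unit:
  assumes "\<xi> \<noteq> 0" "v \<xi> = 0" "\<delta> - \<xi>^2 \<noteq> 0" "v (\<delta> - \<xi>^2) = 0" "\<alpha> \<in> {1, \<delta>}"
  shows "EndL (D (Lam \<alpha>)) = EndL (Lam \<alpha>)"
  using D_Lam_unit[OF assms(1-4)] EndL_scale[OF \<delta>_nz, of "D (Lam \<delta>)" "Lam \<delta>"] assms(5) by auto

lemma EndL_D_Lam_uniformizer:
  assumes "\<xi> / \<delta> \<in> \<oo>" "\<delta> - \<xi>^2 \<noteq> 0" "v (\<delta> - \<xi>^2) = 1"
  shows "EndL (D (Lam 1)) = EndL (Lam \<delta>)" "EndL (D (Lam \<delta>)) = EndL (Lam 1)"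
  by (intro EndL_scale[OF \<delta>_nz] D_Lam_uniformizer[OF assms])+

lemma Lam_\<delta>_subset: "Lam \<delta> \<subseteq> Lam 1"
proof -
  have "x \<in> \<oo>" if "x / \<delta> \<in> \<oo>" for x
    using O_mult[OF \<delta>_int that] \<delta>_nz by simp
  then show ?thesis by (auto simp: Lam_mem)
qed

lemma \<delta>_D_Lam: "x \<in> D (Lam 1) \<Longrightarrow> \<delta> *s x \<in> Lam 1"
proof (cases rule: ramified_cases)
  case unit
  assume "x \<in> D (Lam 1)"
  with D_Lam_unit(1)[OF unit] show ?thesis
    using lattice_Lam(2)[of 1] \<delta>_int by (simp add: o_submodule_def)
next
  case uniformizer
  assume "x \<in> D (Lam 1)"
  with D_Lam_uniformizer(1)[OF uniformizer] Lam_\<delta>_subset show ?thesis by auto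
qed


subsection \<open>Stable orders\<close>

lemma subset_EndL_D:
  assumes "R \<subseteq> EndL L" "J ` R = R"
  shows "R \<subseteq> EndL (D L)"
proof
  fix A assume "A \<in> R"
  with assms(2) obtain B where "A = J B" "B \<in> R" by blast
  with assms(1) show "A \<in> EndL (D L)" using J_EndL_D by blast
qed

text \<open>If \<open>\<delta>\<^sup>n\<^sup>+\<^sup>1\<close> maps the dual of \<open>L\<close> into \<open>L\<close> and \<open>n\<close> is positive, replace \<open>L\<close> by
  \<open>L + \<delta>\<^sup>n D L\<close>: it is still integral because \<open>2 n\<close> is at least \<open>n + 1\<close>.\<close>

lemma near_self_dual_sublattice:
  assumes "o_submodule v (*s) L" "R \<subseteq> EndL L" "J ` R = R" "L \<subseteq> D L"
    "\<And>x. x \<in> D L \<Longrightarrow> \<delta> ^ n *s x \<in> L"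
  shows "\<exists>L'. o_submodule v (*s) L' \<and> R \<subseteq> EndL L' \<and> L' \<subseteq> D L' \<and> (\<forall>x\<in>D L'. \<delta> *s x \<in> L')"
  using assms
proof (induction n arbitrary: L)
  case 0
  then have "\<delta> *s x \<in> L" if "x \<in> D L" for x
    using that o_submoduleD(3)[OF 0(1) \<delta>_int] by simp
  with 0 show ?case by blast
next
  case (Suc n)
  show ?case
  proof (cases "n = 0")
    case True
    \<comment> \<open>The exponent is already 1, which is the bound sought.\<close>
    with Suc.prems show ?thesis by (intro exI[of _ L]) auto
  next
    case False
    then obtain m where m: "n = Suc m" by (cases n) auto
    have D: "o_submodule v (*s) (D L)" by (rule D_submodule)
    define M where "M = {x + \<delta> ^ n *s y | x y. x \<in> L \<and> y \<in> D L}"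
    have MI: "x + \<delta> ^ n *s y \<in> M" if "x \<in> L" "y \<in> D L" for x y
      using that by (auto simp: M_def)
    have ME: "\<exists>x y. z = x + \<delta> ^ n *s y \<and> x \<in> L \<and> y \<in> D L" if "z \<in> M" for z
      using that by (auto simp: M_def)
    have LM: "L \<subseteq> M"
      using MI[of _ 0] o_submoduleD(1)[OF D] by auto
    have "o_submodule v (*s) M"
      unfolding o_submodule_def
    proof (intro conjI ballI)
      show "0 \<in> M" using LM o_submoduleD(1)[OF Suc.prems(1)] by blast
      fix z w assume "z \<in> M"
      then obtain x y where xy: "z = x + \<delta> ^ n *s y" "x \<in> L" "y \<in> D L" using ME by blast
      {
        assume "w \<in> M"
        then obtain x' y' where xy': "w = x' + \<delta> ^ n *s y'" "x' \<in> L" "y' \<in> D L" using ME by blast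
        have "(x + x') + \<delta> ^ n *s (y + y') \<in> M"
          using xy xy' by (intro MI o_submoduleD[OF D] o_submoduleD[OF Suc.prems(1)])
        moreover have "z + w = (x + x') + \<delta> ^ n *s (y + y')"
          using xy xy' by (simp add: vec_eq_iff algebra_simps)
        ultimately show "z + w \<in> M" by simp
      next
        fix r assume "r \<in> \<oo>"
        then have "r *s x + \<delta> ^ n *s (r *s y) \<in> M"
          using xy by (intro MI o_submoduleD[OF D] o_submoduleD[OF Suc.prems(1)])
        moreover have "r *s z = r *s x + \<delta> ^ n *s (r *s y)"
          using xy by (simp add: vec_eq_iff algebra_simps)
        ultimately show "r *s z \<in> M" by simp
      }
    qed
    moreover have "R \<subseteq> EndL M"
    proof
      fix A assume "A \<in> R"
      \<comment> \<open>As \<open>R\<close> is closed under \<open>J\<close>, it stabilises the dual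
        as well, and therefore both summands of \<open>M\<close>.\<close>
      then have "A \<in> EndL (D L)" using subset_EndL_D[OF Suc.prems(2,3)] by blast
      moreover have "A \<in> EndL L" using Suc.prems(2) \<open>A \<in> R\<close> by blast
      ultimately show "A \<in> EndL M"
        unfolding EndL_def using MI
        by (auto simp: matrix_vector_right_distrib vector_scalar_commute dest!: ME)
    qed
    moreover have "M \<subseteq> D M"
    proof
      fix z assume "z \<in> M"
      then obtain x y where xy: "z = x + \<delta> ^ n *s y" "x \<in> L" "y \<in> D L" using ME by blast
      show "z \<in> D M"
        unfolding D_def
      proof (intro CollectI ballI)
        fix w assume "w \<in> M"
        then obtain x' y' where xy': "w = x' + \<delta> ^ n *s y'" "x' \<in> L" "y' \<in> D L" using ME by blast
        \<comment> \<open>The product of the two dual parts carries the exponent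
          \<open>n + n = m + Suc n\<close>; the power \<open>Suc n\<close> brings \<open>y'\<close>
          into \<open>L\<close>.\<close>
        have "b x x' / c \<in> \<oo>" "b y' x / c \<in> \<oo>" "b y x' / c \<in> \<oo>" "b y (\<delta> ^ Suc n *s y') / c \<in> \<oo>"
          using xy xy' Suc.prems(4,5) by (auto simp: D_def)
        then have "b x x' / c + \<delta> ^ n * (b y' x / c) + \<delta> ^ n * (b y x' / c)
            + \<delta> ^ m * (b y (\<delta> ^ Suc n *s y') / c) \<in> \<oo>"
          by (intro O_add O_mult O_power \<delta>_int)
        moreover have "b z w / c = b x x' / c + \<delta> ^ n * (b y' x / c) + \<delta> ^ n * (b y x' / c)
            + \<delta> ^ m * (b y (\<delta> ^ Suc n *s y') / c)"
          unfolding xy(1) xy'(1) m b_add b_add_right b_scale b_scale_right b_sym[of x y']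
          using c_nz by (simp add: field_simps)
        ultimately show "b z w / c \<in> \<oo>" by simp
      qed
    qed
    \<comment> \<open>Enlarging \<open>L\<close> shrinks its dual, so \<open>D M\<close> lies in
      \<open>D L\<close> and the exponent drops by one.\<close>
    moreover have "\<delta> ^ n *s z \<in> M" if "z \<in> D M" for z
      using MI[of 0 z] o_submoduleD(1)[OF Suc.prems(1)] D_antimono[OF LM] that by auto
    ultimately show ?thesis using Suc.IH[of M] Suc.prems(3) by blast
  qed
qed

lemma subset_EndL_Lam:
  assumes R: "is_order v R" "J ` R = R"
  shows "R \<subseteq> EndL (Lam 1) \<or> R \<subseteq> EndL (Lam \<delta>)"
proof -
  have mult: "A ** B \<in> R" if "A \<in> R" "B \<in> R" for A B using R(1) that by (auto simp: is_order_def)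
  have one: "mat 1 \<in> R" using R(1) by (auto simp: is_order_def)
  have sub1: "o_submodule v (*s) (Lam 1)" by (intro lattice_Lam) simp
  obtain S where S: "finite S" "R = o_gen v msc S"
    using R(1) by (auto simp: is_order_def o_lattice_def)
  \<comment> \<open>A common denominator of the entries of finitely many generators serves the whole
    order.\<close>
  have "finite ((\<lambda>(A, i, j). (Q ** A ** P) $ i $ j) ` (S \<times> UNIV))" using S by simp
  from common_denominator[OF this] obtain d where d: "d \<in> \<oo>" "d \<noteq> 0"
    and dS: "\<And>A i j. A \<in> S \<Longrightarrow> d * (Q ** A ** P) $ i $ j \<in> \<oo>" by force
  have "o_submodule v msc {A. \<forall>i j. d * (Q ** A ** P) $ i $ j \<in> \<oo>}"
    unfolding o_submodule_def
    by (auto simp: conj_add conj_msc conj_0 msc_component algebra_simps intro: O_add)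
      (metis O_mult mult.left_commute)
  from o_gen_subset[OF this, of S] dS S
  have dR: "d * (Q ** A ** P) $ i $ j \<in> \<oo>" if "A \<in> R" for A i j using that by auto
  \<comment> \<open>The largest submodule of \<open>Lam 1\<close> stable under \<open>R\<close>. It
    contains \<open>d\<close> times \<open>Lam 1\<close> by the choice of \<open>d\<close>.\<close>
  define L where "L = {x. \<forall>A\<in>R. A *v x \<in> Lam 1}"
  have "o_submodule v (*s) L"
    unfolding o_submodule_def L_def
    by (auto simp: matrix_vector_right_distrib vector_scalar_commute
        intro: o_submoduleD[OF sub1])
  moreover have "R \<subseteq> EndL L"
    by (auto simp: L_def EndL_def matrix_vector_mul_assoc mult)
  moreover have L1: "L \<subseteq> Lam 1"
    using one by (force simp: L_def)
  then have "L \<subseteq> D L"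
    using b_Lam[of 1] by (auto simp: D_def)
  moreover have dL: "d *s x \<in> L" if "x \<in> Lam 1" for x
  proof -
    have "(d * (Q ** A ** P) $ i $ 1) * X x + (d * (Q ** A ** P) $ i $ 2) * Y x \<in> \<oo>" if "A \<in> R" for A i
      using \<open>x \<in> Lam 1\<close> by (intro O_add[OF O_mult O_mult] dR[OF that]) (auto simp: Lam_mem)
    then show ?thesis
      unfolding L_def
      by (auto simp: Lam_mem vector_scalar_commute crd_scale crd_matrix algebra_simps)
  qed
  \<comment> \<open>One factor \<open>d\<close> leads from \<open>D L\<close> to
    \<open>D (Lam 1)\<close>, \<delta> leads on to \<open>Lam 1\<close>, and another
    \<open>d\<close> into \<open>L\<close>. The exponent is chosen so that this power of \<delta> is
    a unit multiple of \<open>\<delta> * d * d\<close>.\<close>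
  moreover have "\<delta> ^ nat (v (\<delta> * d * d)) *s x \<in> L" if "x \<in> D L" for x
  proof -
    have "d *s x \<in> D (Lam 1)"
      using dL that by (auto simp: D_def b_scale b_scale_right dest!: bspec)
    then have *: "d *s (\<delta> *s (d *s x)) \<in> L" by (intro dL \<delta>_D_Lam)
    have "\<delta> ^ nat (v (\<delta> * d * d)) / (\<delta> * d * d) \<in> \<oo>"
      using d \<delta>_nz v_\<delta> by (simp add: O_divide_iff v_power)
    from o_submoduleD(3)[OF \<open>o_submodule v (*s) L\<close> this *] show ?thesis
      using d \<delta>_nz by (simp add: field_simps)
  qed
  ultimately have "\<exists>M. o_submodule v (*s) M \<and> R \<subseteq> EndL M \<and> M \<subseteq> D M \<and> (\<forall>x\<in>D M. \<delta> *s x \<in> M)"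
    using R(2) by (intro near_self_dual_sublattice[of L R "nat (v (\<delta> * d * d))"])
  then obtain M where M: "o_submodule v (*s) M" "R \<subseteq> EndL M" "M \<subseteq> D M"
    and \<delta>M: "\<And>x. x \<in> D M \<Longrightarrow> \<delta> *s x \<in> M"
    by blast
  have DM: "R \<subseteq> EndL (D M)" using M(2) R(2) by (rule subset_EndL_D)
  \<comment> \<open>Since \<open>M\<close> pairs integrally with itself, all its values lie in the
    ideal of \<open>c\<close>, and \<open>Lam 1\<close> contains every such vector.\<close>
  have M1: "M \<subseteq> Lam 1"
    using M(3) by (auto simp: Lam_iff[of 1] D_def)
  have "Lam 1 \<subseteq> D (Lam 1)"
    using b_Lam[of 1] by (auto simp: D_def)
  then have 1: "Lam 1 \<subseteq> D M" using D_antimono[OF M1] by blast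
  show ?thesis
  proof (cases "M = Lam 1 \<or> D M = Lam 1")
    case True
    then show ?thesis using M(2) DM by auto
  next
    case False
    \<comment> \<open>Both inclusions between \<open>M\<close>, \<open>Lam 1\<close> and
      \<open>D M\<close> are strict here, which exhausts the length of \<open>D M\<close> modulo
      \<delta>; so \<open>M\<close> is \<delta> times \<open>D M\<close>.\<close>
    have MD: "\<exists>y\<in>D M. x = \<delta> *s y" if "x \<in> M" for x
      using rank_two_chain[OF D_submodule sub1 M(1) _ _ \<delta>_nz v_\<delta> \<delta>M that] False M1 1 by blast
    \<comment> \<open>Values on \<open>M\<close> gain a factor \<delta>, so \<open>M\<close> lies in
      \<open>Lam \<delta>\<close>. Conversely, \<open>Lam \<delta>\<close> divided by \<delta> pairs
      integrally with \<open>Lam \<delta>\<close>, hence with \<open>M\<close>, and so lies in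
      \<open>D M\<close>.\<close>
    have "M = Lam \<delta>"
    proof
      show "M \<subseteq> Lam \<delta>"
      proof
        fix x assume x: "x \<in> M"
        then obtain y where y: "y \<in> D M" "x = \<delta> *s y" using MD by blast
        then have "b x x / (c * \<delta>) = b y x / c" using \<delta>_nz by (simp add: b_scale)
        then show "x \<in> Lam \<delta>" using x y by (simp add: Lam_iff D_def)
      qed
      show "Lam \<delta> \<subseteq> M"
      proof
        fix x assume x: "x \<in> Lam \<delta>"
        have "b ((1 / \<delta>) *s x) y / c \<in> \<oo>" if "y \<in> M" for y
          using b_Lam[of \<delta> x y] x \<open>M \<subseteq> Lam \<delta>\<close> that by (auto simp: b_scale mult.commute)
        then have "\<delta> *s ((1 / \<delta>) *s x) \<in> M" by (intro \<delta>M) (simp add: D_def)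
        then show "x \<in> M" using \<delta>_nz by simp
      qed
    qed
    then show ?thesis using M(2) by simp
  qed
qed

section \<open>Determination of the maximal stable orders\<close>

lemma dagger_orderI:
  assumes "is_order v R" "\<And>A. A \<in> R \<Longrightarrow> J A \<in> R"
  shows "dagger_order v J R"
proof -
  have "A \<in> J ` R" if "A \<in> R" for A using assms(2)[OF that] J_J[of A] by (metis image_eqI)
  with assms show ?thesis by (auto simp: dagger_order_def)
qed

text \<open>Each \<open>Lam \<alpha>\<close> is self-dual up to scaling, so its stabiliser is
  \<open>J\<close>-stable; an order contained in one of these stabilisers equals it by
  maximality.\<close>

lemma max_dagger_order_unit:
  assumes unit: "\<xi> \<noteq> 0" "v \<xi> = 0" "\<delta> - \<xi>^2 \<noteq> 0" "v (\<delta> - \<xi>^2) = 0"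
    and R: "max_dagger_order v J R"
  shows "\<exists>\<alpha>\<in>{1, \<delta>}. R = EndL (Lam \<alpha>)"
proof -
  have ord: "dagger_order v J (EndL (Lam \<alpha>))" if "\<alpha> \<in> {1, \<delta>}" for \<alpha>
  proof (rule dagger_orderI)
    have "\<alpha> \<noteq> 0" using that \<delta>_nz by auto
    then show "is_order v (EndL (Lam \<alpha>))" by (simp add: EndL_Lam order_Rm)
    show "J A \<in> EndL (Lam \<alpha>)" if "A \<in> EndL (Lam \<alpha>)" for A
      using J_EndL_D[OF that] EndL_D_Lam_unit[OF unit \<open>\<alpha> \<in> {1, \<delta>}\<close>] by simp
  qed
  have "\<exists>\<alpha>\<in>{1, \<delta>}. R \<subseteq> EndL (Lam \<alpha>)"
    using R subset_EndL_Lam[of R] by (auto simp: max_dagger_order_def dagger_order_def)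
  with ord R show ?thesis unfolding max_dagger_order_def by (metis psubsetI)
qed

text \<open>Duality exchanges the two stabilisers, so a \<open>J\<close>-stable order inside one of
  them lies in both, and the intersection is itself \<open>J\<close>-stable.\<close>

lemma max_dagger_order_uniformizer:
  assumes unif: "\<xi> / \<delta> \<in> \<oo>" "\<delta> - \<xi>^2 \<noteq> 0" "v (\<delta> - \<xi>^2) = 1"
    and R: "max_dagger_order v J R"
  shows "R = EndL (Lam 1) \<inter> EndL (Lam \<delta>)"
proof -
  note E = EndL_D_Lam_uniformizer[OF unif]
  have "dagger_order v J (EndL (Lam 1) \<inter> EndL (Lam \<delta>))"
  proof (rule dagger_orderI)
    show "is_order v (EndL (Lam 1) \<inter> EndL (Lam \<delta>))"
      using \<delta>_nz \<delta>_int by (simp add: EndL_Lam_Int order_Rm)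
    show "J A \<in> EndL (Lam 1) \<inter> EndL (Lam \<delta>)" if "A \<in> EndL (Lam 1) \<inter> EndL (Lam \<delta>)" for A
      using that J_EndL_D[of A] E by blast
  qed
  moreover have "R \<subseteq> EndL (Lam 1) \<inter> EndL (Lam \<delta>)"
  proof -
    have "J ` R = R" "R \<subseteq> EndL (Lam 1) \<or> R \<subseteq> EndL (Lam \<delta>)"
      using R subset_EndL_Lam[of R] by (auto simp: max_dagger_order_def dagger_order_def)
    with subset_EndL_D[of R "Lam 1"] subset_EndL_D[of R "Lam \<delta>"] show ?thesis unfolding E by blast
  qed
  ultimately show ?thesis using R unfolding max_dagger_order_def by blast
qed

section \<open>Similitudes and conjugacy\<close>

text \<open>Adjoints are determined by the nondegenerate form, and a similitude changes it by a
  constant that appears equally on both sides of the adjunction.\<close>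

lemma dagger_auto_similitude:
  assumes gh: "g ** h = mat 1" "h ** g = mat 1"
    and sim: "\<And>x y. b (g *v x) (g *v y) = \<mu> * b x y"
  shows "dagger_auto J (\<lambda>A. g ** A ** h)"
  unfolding dagger_auto_def
proof (intro conjI allI)
  have canc: "h ** (g ** A ** h) ** g = A" "g ** (h ** A ** g) ** h = A" for A
    by (metis gh matrix_mul_assoc matrix_mul_lid matrix_mul_rid)+
  then show "bij (\<lambda>A. g ** A ** h)"
    by (intro bij_betw_byWitness[of _ "\<lambda>A. h ** A ** g"]) auto
  fix A B :: "'a^2^2" and r :: 'a
  show "g ** (A + B) ** h = g ** A ** h + g ** B ** h"
    by (simp add: vec_eq_iff matrix_mult_2 algebra_simps)
  show "g ** (A ** B) ** h = (g ** A ** h) ** (g ** B ** h)"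
    by (metis gh(2) matrix_mul_assoc matrix_mul_rid)
  show "g ** msc r A ** h = msc r (g ** A ** h)"
    by (simp add: msc_mult_left msc_mult_right)
  show "g ** mat 1 ** h = mat 1" by (simp add: gh)
  have "b ((g ** J A ** h) *v x - J (g ** A ** h) *v x) y = 0" for x y
  proof -
    have "b ((g ** J A ** h) *v x) y = b (g *v (J A *v (h *v x))) (g *v (h *v y))"
      by (simp add: matrix_vector_mul_assoc gh matrix_mul_assoc)
    also have "\<dots> = b (g *v (h *v x)) (g *v (A *v (h *v y)))"
      by (simp add: sim flip: b_adj)
    also have "\<dots> = b (J (g ** A ** h) *v x) y"
      unfolding b_adj[symmetric] by (simp add: matrix_vector_mul_assoc gh matrix_mul_assoc)
    finally have eq: "b ((g ** J A ** h) *v x) y = b (J (g ** A ** h) *v x) y" .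
    have "b ((g ** J A ** h) *v x - J (g ** A ** h) *v x) y
        = b ((g ** J A ** h) *v x) y + (- 1) * b (J (g ** A ** h) *v x) y"
      unfolding b_scale[symmetric] b_add[symmetric] by (simp add: vec_eq_iff)
    with eq show ?thesis by simp
  qed
  from b_nondeg[OF this] have "(g ** J A ** h) *v x = J (g ** A ** h) *v x" for x by simp
  then show "g ** J A ** h = J (g ** A ** h)" by (simp add: matrix_eq)
qed

lemma conj_image_EndL:
  assumes gh: "g ** h = mat 1" "h ** g = mat 1" and L: "\<And>x. x \<in> L1 \<longleftrightarrow> g *v x \<in> L2"
  shows "(\<lambda>A. g ** A ** h) ` EndL L1 = EndL L2"
proof
  have canc: "g *v (h *v x) = x" "h *v (g *v x) = x" for x
    by (simp_all add: matrix_vector_mul_assoc gh)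
  show "(\<lambda>A. g ** A ** h) ` EndL L1 \<subseteq> EndL L2"
    by (auto simp: EndL_def L canc simp flip: matrix_vector_mul_assoc)
  show "EndL L2 \<subseteq> (\<lambda>A. g ** A ** h) ` EndL L1"
  proof
    fix B assume B: "B \<in> EndL L2"
    have "B = g ** (h ** B ** g) ** h"
      by (metis gh(1) matrix_mul_assoc matrix_mul_lid matrix_mul_rid)
    moreover have "h ** B ** g \<in> EndL L1"
      using B by (auto simp: EndL_def L canc simp flip: matrix_vector_mul_assoc)
    ultimately show "B \<in> (\<lambda>A. g ** A ** h) ` EndL L1" by blast
  qed
qed

text \<open>The matrix of \<open>g\<close> is multiplication by \<pi> on \<open>K\<close> in the
  basis 1, \<pi>, where \<pi> squared is \<open>2 * \<xi>\<close> times \<pi> minus \<delta>. Its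
  multiplier is the norm \<delta> of \<pi>, and it shifts each power of the maximal ideal of
  \<open>K\<close> to the next.\<close>

lemma similitude_swaps_Lam:
  "\<exists>g h. g ** h = mat 1 \<and> h ** g = mat 1 \<and> (\<forall>x y. b (g *v x) (g *v y) = \<delta> * b x y) \<and>
    (\<forall>x. x \<in> Lam 1 \<longleftrightarrow> g *v x \<in> Lam \<delta>) \<and> (\<forall>x. \<delta> *s x \<in> Lam \<delta> \<longleftrightarrow> g *v x \<in> Lam 1)"
proof (intro exI conjI allI)
  let ?g = "mat_of 0 (- \<delta>) 1 (2 * \<xi>)" and ?h = "mat_of (2 * \<xi> / \<delta>) 1 (- 1 / \<delta>) 0"
  have id: "(Q ** mat 1 ** P) $ i $ j = (if i = j then 1 else 0)" for i j
    by (simp only: matrix_mul_rid QP) (simp add: mat_def)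
  have "(Q ** (?g ** ?h) ** P) $ i $ j = (Q ** mat 1 ** P) $ i $ j"
    "(Q ** (?h ** ?g) ** P) $ i $ j = (Q ** mat 1 ** P) $ i $ j" for i j
    using exhaust_2[of i] exhaust_2[of j] \<delta>_nz
    unfolding id by (auto simp: conj_mult_component)
  then show "?g ** ?h = mat 1" "?h ** ?g = mat 1"
    by (auto intro: mat_eqI)
  have X: "X (?g *v x) = - \<delta> * Y x" and Y: "Y (?g *v x) = X x + 2 * \<xi> * Y x" for x
    by (simp_all add: crd_matrix)
  show "b (?g *v x) (?g *v y) = \<delta> * b x y" for x y
    unfolding b_eq X Y by (simp add: algebra_simps)
  have iff: "s + t \<in> \<oo> \<longleftrightarrow> s \<in> \<oo>" if "t \<in> \<oo>" for s t
    using O_add[of s t] O_diff[of "s + t" t] that by auto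
  show "x \<in> Lam 1 \<longleftrightarrow> ?g *v x \<in> Lam \<delta>" for x
  proof -
    have "2 * \<xi> * Y x \<in> \<oo>" if "Y x \<in> \<oo>"
      by (intro O_mult O_2 \<xi>_int that)
    then show ?thesis
      using \<delta>_nz iff[of "2 * \<xi> * Y x" "X x"] by (auto simp: Lam_mem X Y)
  qed
  show "\<delta> *s x \<in> Lam \<delta> \<longleftrightarrow> ?g *v x \<in> Lam 1" for x
  proof -
    \<comment> \<open>Here \<open>Y x\<close> may have denominator \<delta>; the factor 2 absorbs it
      because the place is dyadic.\<close>
    have "2 * \<xi> * Y x \<in> \<oo>" if "\<delta> * Y x \<in> \<oo>"
      using O_mult[OF two_divisible O_mult[OF \<xi>_int that]] \<delta>_nz by (simp add: field_simps)
    then show ?thesis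
      using \<delta>_nz iff[of "2 * \<xi> * Y x" "X x"] by (auto simp: Lam_mem X Y crd_scale)
  qed
qed

lemma max_dagger_orders_conjugate:
  assumes R: "max_dagger_order v J R1" "max_dagger_order v J R2"
  shows "\<exists>f. dagger_auto J f \<and> f ` R1 = R2"
proof -
  have id: "\<exists>f. dagger_auto J f \<and> f ` R = R" for R
    by (intro exI[of _ id]) (simp add: dagger_auto_def)
  obtain g h where gh: "g ** h = mat 1" "h ** g = mat 1"
    and sim: "\<And>x y. b (g *v x) (g *v y) = \<delta> * b x y"
    and swap: "\<And>x. x \<in> Lam 1 \<longleftrightarrow> g *v x \<in> Lam \<delta>" "\<And>x. \<delta> *s x \<in> Lam \<delta> \<longleftrightarrow> g *v x \<in> Lam 1"
    using similitude_swaps_Lam by meson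
  note auto = dagger_auto_similitude[OF gh sim]
  have 1: "(\<lambda>A. g ** A ** h) ` EndL (Lam 1) = EndL (Lam \<delta>)"
    using gh swap(1) by (rule conj_image_EndL)
  \<comment> \<open>To return from \<open>Lam \<delta>\<close> to \<open>Lam 1\<close>, first divide
    by \<delta>: this keeps the stabiliser, and \<open>g\<close> then lands on
    \<open>Lam 1\<close>.\<close>
  have "(\<lambda>A. g ** A ** h) ` EndL {x. \<delta> *s x \<in> Lam \<delta>} = EndL (Lam 1)"
    by (rule conj_image_EndL[OF gh]) (simp add: swap(2))
  moreover have "EndL {x. \<delta> *s x \<in> Lam \<delta>} = EndL (Lam \<delta>)"
    by (rule EndL_scale[OF \<delta>_nz]) simp
  ultimately have 2: "(\<lambda>A. g ** A ** h) ` EndL (Lam \<delta>) = EndL (Lam 1)" by simp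
  show ?thesis
  proof (cases rule: ramified_cases)
    case unit
    from max_dagger_order_unit[OF unit R(1)] max_dagger_order_unit[OF unit R(2)]
    show ?thesis using id auto 1 2 by blast
  next
    case uniformizer
    from max_dagger_order_uniformizer[OF uniformizer R(1)] max_dagger_order_uniformizer[OF uniformizer R(2)]
    show ?thesis using id by blast
  qed
qed


subsection \<open>Reduced discriminants\<close>

lemma disc_ideal_Rm:
  assumes "\<alpha> \<noteq> 0" "\<beta> \<noteq> 0"
  shows "disc_ideal v (Rm \<alpha> \<beta>) = {(\<alpha> * \<beta>)^2 * r | r. r \<in> \<oo>}"
proof -
  \<comment> \<open>\<open>S\<close> is the Gram matrix of the trace form on the natural basis of
    \<open>Rm \<alpha> \<beta>\<close>, and \<open>crd x\<close> holds coordinates in that basis.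
    Every Gram determinant is thus \<open>det S\<close> times a square.\<close>
  define S :: "'a^4^4" where "S = (\<chi> m n. if m = 1 \<and> n = 1 \<or> m = 4 \<and> n = 4 then 1
    else if m = 2 \<and> n = 3 \<or> m = 3 \<and> n = 2 then \<alpha> * \<beta> else 0)"
  define crd :: "(4 \<Rightarrow> 'a^2^2) \<Rightarrow> 'a^4^4" where "crd x = (\<chi> i m.
    if m = 1 then (Q ** x i ** P) $ 1 $ 1 else if m = 2 then (Q ** x i ** P) $ 1 $ 2 / \<alpha>
    else if m = 3 then (Q ** x i ** P) $ 2 $ 1 / \<beta> else (Q ** x i ** P) $ 2 $ 2)" for x
  have mult_4: "(A ** B) $ i $ j = A $ i $ 1 * B $ 1 $ j + A $ i $ 2 * B $ 2 $ j
      + A $ i $ 3 * B $ 3 $ j + A $ i $ 4 * B $ 4 $ j" for A B :: "'a^4^4" and i j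
    by (simp add: matrix_matrix_mult_def sum_4)
  have trd_conj: "trd (Q ** A ** P) = trd A" for A
    using trd_commute[of "Q ** A" P] by (simp add: matrix_mul_assoc PQ)
  have gram: "(\<chi> i j. trd (x i ** x j)) = crd x ** S ** transpose (crd x)" for x
  proof -
    have "trd (x i ** x j) = (crd x ** S ** transpose (crd x)) $ i $ j" for i j
      unfolding trd_conj[of "x i ** x j", symmetric]
      using assms by (simp add: trd_def sum_2 conj_mult_component mult_4 crd_def S_def transpose_def)
    then show ?thesis by (simp add: vec_eq_iff)
  qed
  have det: "det (\<chi> i j. trd (x i ** x j)) = det S * (det (crd x))^2" for x
    unfolding gram by (simp add: det_mul det_transpose power2_eq_square)
  \<comment> \<open>The square of \<open>S\<close> is diagonal, which gives \<open>det S\<close> up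
    to sign without a 4 by 4 expansion; the valuation is all that the ideal requires.\<close>
  have "(S ** S) $ i $ j = 0" if "i \<noteq> j" for i j
    using that exhaust_4[of i] exhaust_4[of j]
    by (auto simp: S_def mult_4)
  then have "det (S ** S) = (\<Prod>i\<in>UNIV. (S ** S) $ i $ i)" by (rule det_diagonal)
  also have "\<dots> = (\<alpha> * \<beta>)^4"
    unfolding UNIV_4 by (simp add: S_def mult_4 power4_eq_xxxx ac_simps)
  finally have sq: "det S * det S = (\<alpha> * \<beta>)^4" by (simp add: det_mul)
  then have nz: "det S \<noteq> 0" using assms by auto
  have "v (det S * det S) = v ((\<alpha> * \<beta>)^4)" unfolding sq ..
  then have vS: "v (det S) = v ((\<alpha> * \<beta>)^2)"
    using nz assms by (simp add: v_mult v_power)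
  let ?G = "{det ((\<chi> i j. trd (x i ** x j)) :: 'a^4^4) | x :: 4 \<Rightarrow> 'a^2^2. \<forall>i. x i \<in> Rm \<alpha> \<beta>}"
  have "o_gen v (*) ?G = {det S * r | r. r \<in> \<oo>}"
  proof (rule o_gen_principal)
    \<comment> \<open>The natural basis has the identity as coordinate matrix, so
      \<open>det S\<close> itself occurs among the generators.\<close>
    define x :: "4 \<Rightarrow> 'a^2^2" where "x i = (if i = 1 then mat_of 1 0 0 0 else if i = 2 then mat_of 0 \<alpha> 0 0
      else if i = 3 then mat_of 0 0 \<beta> 0 else mat_of 0 0 0 1)" for i
    have "x i \<in> Rm \<alpha> \<beta>" for i using assms by (simp add: x_def Rm_def)
    moreover have "crd x $ i $ m = mat 1 $ i $ m" for i m
      using exhaust_4[of i] exhaust_4[of m] assms by (auto simp: crd_def x_def mat_def)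
    then have "crd x = mat 1" by (simp add: vec_eq_iff)
    with det[of x] have "det (\<chi> i j. trd (x i ** x j)) = det S" by simp
    ultimately show "det S \<in> ?G" by (intro CollectI exI[of _ x]) simp
    show "?G \<subseteq> {det S * r | r. r \<in> \<oo>}"
    proof
      fix d assume "d \<in> ?G"
      then obtain x where x: "d = det ((\<chi> i j. trd (x i ** x j)) :: 'a^4^4)" "\<And>i. x i \<in> Rm \<alpha> \<beta>" by blast
      have "det (crd x) \<in> \<oo>" by (rule O_det) (use x(2) in \<open>simp add: crd_def Rm_def\<close>)
      with x(1) det show "d \<in> {det S * r | r. r \<in> \<oo>}" by (intro principal_mem[OF O_power]) auto
    qed
  qed
  also have "\<dots> = {(\<alpha> * \<beta>)^2 * r | r. r \<in> \<oo>}"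
    by (rule principal_ideal_cong[OF nz _ vS]) (use assms in simp)
  finally show ?thesis unfolding disc_ideal_def .
qed

lemma reduced_disc_Rm:
  assumes "\<alpha> \<noteq> 0" "\<beta> \<noteq> 0" "z \<noteq> 0" "v z = v (\<alpha> * \<beta>)"
  shows "reduced_disc v (Rm \<alpha> \<beta>) = {z * r | r. r \<in> \<oo>}"
proof -
  have "reduced_disc v (Rm \<alpha> \<beta>) = {\<alpha> * \<beta> * r | r. r \<in> \<oo>}"
    using assms by (intro reduced_disc_eq disc_ideal_Rm) auto
  also have "\<dots> = {z * r | r. r \<in> \<oo>}" using assms by (intro principal_ideal_cong) auto
  finally show ?thesis .
qed

text \<open>The discriminant matches \<open>\<delta> - \<xi>^2\<close> in both cases: a single
  stabiliser has valuation 0, where that element is a unit, and the Eichler order has valuation 1,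
  where it is a uniformizer.\<close>

lemma max_dagger_order_structure:
  assumes R: "max_dagger_order v J R"
  shows "(\<exists>a L. frac_ideal v a \<and> a_maximal v b a L \<and> R = EndL L \<inter> EndL (dual_lat v b L))"
    and "reduced_disc v R = {(\<delta> - \<xi>^2) * r | r. r \<in> \<oo>}"
proof -
  have frac: "frac_ideal v {c * \<alpha> * r | r. r \<in> \<oo>}" if "\<alpha> \<in> {1, \<delta>}" for \<alpha>
    using that c_nz \<delta>_nz by (intro frac_ideal_principal) auto
  have "(\<exists>\<alpha>\<in>{1, \<delta>}. R = EndL (Lam \<alpha>) \<inter> EndL (dual_lat v b (Lam \<alpha>))) \<and>
    reduced_disc v R = {(\<delta> - \<xi>^2) * r | r. r \<in> \<oo>}"
  proof (cases rule: ramified_cases)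
    case unit
    from max_dagger_order_unit[OF unit R] obtain \<alpha> where \<alpha>: "\<alpha> \<in> {1, \<delta>}" "R = EndL (Lam \<alpha>)" by blast
    then have "\<alpha> \<noteq> 0" using \<delta>_nz by auto
    then have "reduced_disc v R = {(\<delta> - \<xi>^2) * r | r. r \<in> \<oo>}"
      unfolding \<alpha>(2) EndL_Lam[OF \<open>\<alpha> \<noteq> 0\<close>]
      by (intro reduced_disc_Rm unit) (auto simp: unit v_1)
    moreover have "R = EndL (Lam \<alpha>) \<inter> EndL (dual_lat v b (Lam \<alpha>))"
      unfolding EndL_dual_lat EndL_D_Lam_unit[OF unit \<alpha>(1)] \<alpha>(2) by simp
    ultimately show ?thesis using \<alpha>(1) by blast
  next
    case uniformizer
    have R_eq: "R = EndL (Lam 1) \<inter> EndL (Lam \<delta>)"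
      by (rule max_dagger_order_uniformizer[OF uniformizer R])
    then have "R = EndL (Lam 1) \<inter> EndL (dual_lat v b (Lam 1))"
      by (simp add: EndL_dual_lat EndL_D_Lam_uniformizer[OF uniformizer])
    moreover have "reduced_disc v R = {(\<delta> - \<xi>^2) * r | r. r \<in> \<oo>}"
      unfolding R_eq EndL_Lam_Int using \<delta>_nz
      by (intro reduced_disc_Rm uniformizer) (auto simp: uniformizer v_\<delta>)
    ultimately show ?thesis by blast
  qed
  then show "\<exists>a L. frac_ideal v a \<and> a_maximal v b a L \<and> R = EndL L \<inter> EndL (dual_lat v b L)"
    "reduced_disc v R = {(\<delta> - \<xi>^2) * r | r. r \<in> \<oo>}"
    using frac a_maximal_Lam by blast+
qed

end

section \<open>Reduction to the Eisenstein form\<close>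

text \<open>A uniformizer lies in the defect, so every difference \<open>\<alpha> - \<xi>^2\<close>
  is nonzero of valuation at most 1. Were none of valuation 1, all would divide 1 and the defect
  would contain 1.\<close>

lemma (in dval) qdefect_uniformizer:
  assumes "qdefect v \<alpha> = vprime v" "\<alpha> \<in> \<oo>"
  obtains \<xi> where "\<xi> \<in> \<oo>" "\<alpha> - \<xi>^2 \<noteq> 0" "v (\<alpha> - \<xi>^2) = 1"
proof -
  obtain p where p: "p \<noteq> 0" "v p = 1" using dv by (auto simp: discrete_valuation_def)
  have "p \<in> qdefect v \<alpha>" using p assms(1) by (simp add: vprime_def)
  then have "\<exists>r. p = (\<alpha> - \<xi>^2) * r \<and> r \<in> \<oo>" for \<xi> by (auto simp: qdefect_def)
  then have nz: "\<alpha> - \<xi>^2 \<noteq> 0" and quot: "p / (\<alpha> - \<xi>^2) \<in> \<oo>" for \<xi>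
    using p(1) by (metis mult_zero_left, metis mult_zero_left nonzero_mult_div_cancel_left)
  have le: "v (\<alpha> - \<xi>^2) \<le> 1" for \<xi>
    using quot[of \<xi>] nz[of \<xi>] p by (simp add: O_divide_iff)
  have "\<exists>\<xi>. 1 \<le> v (\<alpha> - \<xi>^2)"
  proof (rule ccontr)
    assume "\<not> ?thesis"
    then have "v (\<alpha> - \<xi>^2) < 1" for \<xi> by (simp add: not_le)
    then have "v (\<alpha> - \<xi>^2) \<le> v 1" for \<xi> unfolding v_1 by (simp only: zle_diff1_eq[symmetric] diff_self)
    then have "1 / (\<alpha> - \<xi>^2) \<in> \<oo>" for \<xi> using nz by (simp add: O_divide_iff)
    then have "1 \<in> {(\<alpha> - \<xi>^2) * r | r. r \<in> \<oo>}" for \<xi>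
      using nz by (intro principal_mem[of "1 / (\<alpha> - \<xi>^2)"]) simp_all
    then have "1 \<in> qdefect v \<alpha>" by (auto simp: qdefect_def)
    then show False by (simp add: assms(1) vprime_def v_1)
  qed
  then obtain \<xi> where \<xi>: "v (\<alpha> - \<xi>^2) = 1" using le by (metis antisym)
  have "\<xi> \<in> \<oo>"
  proof -
    have "\<alpha> - (\<alpha> - \<xi>^2) \<in> \<oo>" by (rule O_diff[OF assms(2)]) (simp add: O_iff \<xi>)
    then show ?thesis by (cases "\<xi> = 0") (simp_all add: O_iff v_power)
  qed
  with \<xi> nz that show ?thesis by blast
qed

lemma cayley_hamilton_2:
  fixes A :: "'a::comm_ring_1^2^2"
  shows "A *v (A *v x) = (A $ 1 $ 1 + A $ 2 $ 2) *s (A *v x) - det A *s x"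
  by (simp add: vec_eq_iff forall_2 matrix_vector_mult_2 det_2 algebra_simps)

text \<open>An orthogonal vector to \<open>x\<close> is \<open>h x\<close>, for \<open>h\<close> a skew element.\<close>

lemma adapted_basis:
  fixes J :: "'a::field_char_0^2^2 \<Rightarrow> 'a^2^2"
  assumes J: "orth_inv J" and b: "adapted_form J b" and lam: "lam \<in> disc_inv J" "lam \<noteq> 0"
  obtains c x y where "c \<noteq> 0" "b x x = c" "b x y = 0" "b y y = c * lam"
proof -
  note b_add = adapted_form_add[OF b] and b_scale = adapted_form_scale[OF b]
    and b_sym = adapted_form_sym[OF b] and b_adj = adapted_form_adjoint[OF b]
  obtain A where "J A \<noteq> A" using J by (auto simp: orth_inv_def fun_eq_iff)
  have J_add: "J (A + B) = J A + J B" and J_J: "J (J A) = A" for A B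
    using J unfolding orth_inv_def by blast+
  have "J (A - J A) = - (A - J A)"
    using J_add[of "A - J A" "J A"] J_J[of A] by (simp add: algebra_simps)
  with \<open>J A \<noteq> A\<close> have ex: "\<exists>h. h \<noteq> 0 \<and> J h = - h" by (intro exI[of _ "A - J A"]) auto
  \<comment> \<open>The same choice as in \<open>disc_inv\<close>, so that \<open>det h\<close> is
    the representative used there.\<close>
  define h where "h = (SOME h. h \<noteq> 0 \<and> J h = - h)"
  have h: "J h = - h" using someI_ex[OF ex] unfolding h_def by blast
  obtain k where k: "k \<noteq> 0" "lam = det h * k^2"
    using lam(1) by (auto simp: disc_inv_def Let_def h_def)
  have "\<exists>x. b x x \<noteq> 0"
  proof (rule ccontr)
    assume *: "\<not> ?thesis"
    \<comment> \<open>Polarisation, which may divide by 2 in characteristic zero.\<close>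
    have "b x y = 0" for x y
    proof -
      have "b (x + y) (x + y) = b x x + b y y + 2 * b x y"
        using b_add[of x y "x + y"] b_add[of x y x] b_add[of x y y] b_sym[of x "x + y"] b_sym[of y "x + y"]
          b_sym[of x y] by simp
      with * show ?thesis by simp
    qed
    then have "x = 0" for x :: "'a^2" by (intro adapted_form_nondegenerate[OF b])
    from this[of "axis 1 1"] show False by (simp add: axis_eq_0_iff)
  qed
  then obtain x where x: "b x x \<noteq> 0" by blast
  have neg: "(- h) *v z = - (h *v z)" for z
    by (simp add: vec_eq_iff matrix_vector_mult_2)
  have "b x (h *v x) = b (- (h *v x)) x" using b_adj[of x h x] by (simp add: h neg)
  also have "\<dots> = - b x (h *v x)" using b_scale[of "-1" "h *v x" x] b_sym[of x "h *v x"] by simp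
  finally have "2 * b x (h *v x) = 0" by simp
  then have skew: "b x (h *v x) = 0" by simp
  have "b (h *v x) (h *v x) = b (- (h *v (h *v x))) x"
    using b_adj[of "h *v x" h x] by (simp add: h neg)
  \<comment> \<open>Cayley-Hamilton; the trace term disappears because \<open>h *v x\<close> is
    orthogonal to \<open>x\<close>.\<close>
  also have "- (h *v (h *v x)) = (- (h $ 1 $ 1 + h $ 2 $ 2)) *s (h *v x) + det h *s x"
    by (simp add: cayley_hamilton_2)
  also have "b \<dots> x = b x x * det h"
    unfolding b_add b_scale using skew b_sym[of x "h *v x"] by simp
  finally have hh: "b (h *v x) (h *v x) = b x x * det h" .
  \<comment> \<open>Scaling by \<open>k\<close> moves \<open>det h\<close> to \<open>lam\<close>
    within its square class.\<close>
  have "b x (k *s (h *v x)) = 0"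
    by (simp add: adapted_form_scale_right[OF b] skew)
  moreover have "b (k *s (h *v x)) (k *s (h *v x)) = k^2 * b (h *v x) (h *v x)"
    by (simp add: b_scale adapted_form_scale_right[OF b] power2_eq_square)
  then have "b (k *s (h *v x)) (k *s (h *v x)) = b x x * lam"
    unfolding hh k(2) by (simp add: ac_simps)
  ultimately show ?thesis using that[of "b x x" x "k *s (h *v x)"] x by blast
qed

theorem theorem7p2:
  fixes v :: "'a::field_char_0 \<Rightarrow> int"
    and J :: "'a^2^2 \<Rightarrow> 'a^2^2"
    and b :: "'a^2 \<Rightarrow> 'a^2 \<Rightarrow> 'a"
    and lam :: 'a
    and R :: "('a^2^2) set"
  assumes "nonarch_local_field v"
    and "dyadic v"
    and "orth_inv J"
    and "adapted_form J b"
    and "lam \<in> disc_inv J \<inter> vring v"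
    and "{lam * c | c. c \<in> vring v} = iota v (disc_inv J)"
    and "qdefect v (- lam) = vprime v"
    and "max_dagger_order v J R"
  shows "(\<exists>a L. frac_ideal v a \<and> a_maximal v b a L \<and> R = EndL L \<inter> EndL (dual_lat v b L))
    \<and> (\<forall>R1 R2. max_dagger_order v J R1 \<and> max_dagger_order v J R2 \<longrightarrow>
          (\<exists>f. dagger_auto J f \<and> f ` R1 = R2))
    \<and> reduced_disc v R = disc_H v \<inter> iota v (disc_inv J)"
proof -
  interpret dval v using assms(1) by unfold_locales (simp add: nonarch_local_field_def)
  have lam: "lam \<in> disc_inv J" "lam \<in> \<oo>" using assms(5) by auto
  obtain \<xi> where \<xi>: "\<xi> \<in> \<oo>" "- lam - \<xi>^2 \<noteq> 0" "v (- lam - \<xi>^2) = 1"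
    using qdefect_uniformizer[OF assms(7)] lam(2) by auto
  define \<delta> where "\<delta> = lam + \<xi>^2"
  have "\<delta> = - (- lam - \<xi>^2)" by (simp add: \<delta>_def)
  with \<xi>(2,3) have \<delta>: "\<delta> \<noteq> 0" "v \<delta> = 1" by (simp_all only: v_minus neg_equal_0_iff_equal not_False_eq_True)
  \<comment> \<open>Otherwise \<open>- (\<xi>^2)\<close> would have odd valuation 1.\<close>
  have "lam \<noteq> 0"
  proof
    assume "lam = 0"
    then have "v (- lam - \<xi>^2) = 2 * v \<xi>" using \<xi>(2) by (simp add: v_minus v_power)
    with \<xi>(3) show False by presburger
  qed
  obtain c x y where c: "c \<noteq> 0" "b x x = c" "b x y = 0" "b y y = c * lam"
    using adapted_basis[OF assms(3,4) lam(1) \<open>lam \<noteq> 0\<close>] .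
  note b_add = adapted_form_add[OF assms(4)] and b_scale = adapted_form_scale[OF assms(4)]
    and b_sym = adapted_form_sym[OF assms(4)]
    and b_add' = adapted_form_add_right[OF assms(4)] and b_scale' = adapted_form_scale_right[OF assms(4)]
  \<comment> \<open>This shear turns the diagonal form with entries \<open>c\<close>,
    \<open>c * lam\<close> into the Eisenstein form; completing the square would undo it.\<close>
  define e where "e = y + \<xi> *s x"
  have gram: "b x x = c" "b x e = c * \<xi>" "b e x = c * \<xi>" "b e e = c * \<delta>"
    using c b_sym[of y x]
    by (simp_all add: e_def b_add b_scale b_add' b_scale' \<delta>_def power2_eq_square algebra_simps)
  define P :: "'a^2^2" where "P = (\<chi> i j. if j = 1 then x $ i else e $ i)"
  have P: "P *v z = (z $ 1) *s x + (z $ 2) *s e" for z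
    by (simp add: vec_eq_iff matrix_vector_mult_2 P_def mult.commute)
  \<comment> \<open>A kernel vector pairs to zero with both basis vectors, and the Gram determinant
    is \<open>c^2 * lam\<close>, which is nonzero.\<close>
  have "\<forall>z. P *v z = 0 \<longrightarrow> z = 0"
  proof (intro allI impI)
    fix z assume that: "P *v z = 0"
    have "b 0 w = 0" for w using b_scale[of 0 0 w] by simp
    then have "b (P *v z) x = 0" "b (P *v z) e = 0" unfolding that by simp_all
    then have "c * (z $ 1 + z $ 2 * \<xi>) = 0" "c * (z $ 1 * \<xi> + z $ 2 * \<delta>) = 0"
      unfolding P b_add b_scale gram by (simp_all add: algebra_simps)
    then have eqs: "z $ 1 + z $ 2 * \<xi> = 0" "z $ 1 * \<xi> + z $ 2 * \<delta> = 0" using c(1) by auto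
    have "z $ 2 * lam = (z $ 1 * \<xi> + z $ 2 * \<delta>) - \<xi> * (z $ 1 + z $ 2 * \<xi>)"
      by (simp add: \<delta>_def power2_eq_square algebra_simps)
    then have "z $ 2 = 0" using eqs \<open>lam \<noteq> 0\<close> by simp
    with eqs(1) show "z = 0" by (simp add: vec_eq_iff forall_2)
  qed
  then have "\<exists>Q. Q ** P = mat 1" by (simp only: matrix_left_invertible_ker)
  then obtain Q where QP: "Q ** P = mat 1" ..
  then have PQ: "P ** Q = mat 1" using matrix_left_right_inverse by blast
  interpret ramified_form v J b c \<xi> \<delta> P Q
  proof
    show "0 < v 2" using assms(2) by (simp add: dyadic_def)
    show "J (J A) = A" for A using assms(3) by (simp add: orth_inv_def)
    show "b z w = c * ((Q *v z) $ 1 * (Q *v w) $ 1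
      + \<xi> * ((Q *v z) $ 1 * (Q *v w) $ 2 + (Q *v z) $ 2 * (Q *v w) $ 1)
      + \<delta> * (Q *v z) $ 2 * (Q *v w) $ 2)" for z w
    proof -
      have "b (P *v (Q *v z)) (P *v (Q *v w)) = c * ((Q *v z) $ 1 * (Q *v w) $ 1
        + \<xi> * ((Q *v z) $ 1 * (Q *v w) $ 2 + (Q *v z) $ 2 * (Q *v w) $ 1)
        + \<delta> * (Q *v z) $ 2 * (Q *v w) $ 2)"
        unfolding P b_add b_scale b_add' b_scale' gram by (simp add: algebra_simps)
      moreover have "P *v (Q *v u) = u" for u by (simp add: matrix_vector_mul_assoc PQ)
      ultimately show ?thesis by (simp only:)
    qed
  qed (use assms(4) PQ QP c(1) \<delta> \<xi>(1) in auto)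
  \<comment> \<open>As \<open>lam\<close> is integral, intersecting its ideal with the discriminant
    of \<open>H\<close>, the whole valuation ring, changes nothing.\<close>
  have "{lam * r | r. r \<in> \<oo>} \<subseteq> \<oo>" using lam(2) by (auto intro: O_mult)
  then have "disc_H v \<inter> iota v (disc_inv J) = {lam * r | r. r \<in> \<oo>}"
    unfolding disc_H_def assms(6)[symmetric] by blast
  moreover have "\<delta> - \<xi>^2 = lam" by (simp add: \<delta>_def)
  ultimately show ?thesis
    using max_dagger_order_structure[OF assms(8)] max_dagger_orders_conjugate by auto
qed

end
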